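(* There exists a recursive countable weakly transitive quasiminimal subshift $X$ for which the counting problem is $\Sigma^0_1$-complete, and which has exactly four nonempty proper subsystems, namely $\mathcal{L}^{-1}(0^*(1+2)0^* )$, $\mathcal{L}^{-1}(0^*20^* )$, $\mathcal{L}^{-1}(0^*10^* )$ and $\mathcal{L}^{-1}(0^* )$.
   Context: For a finite alphabet $S$, give $S^{\mathbb{Z}}$ the product topology and the shift $\sigma(x)_i = x_{i+1}$. A subshift is a closed set $X \subset S^{\mathbb{Z}}$ with $\sigma(X)=X$; a subsystem of $X$ is a subshift $Y \subset X$. $X$ is quasiminimal if it has finitely many proper subshifts. The language $\mathcal{L}(X)$ is the set of finite words occurring as contiguous subwords of points of $X$; $X$ is recursive if $\mathcal{L}(X)$ is recursive. $X$ is weakly transitive if some point $x \in X$ contains every word of $\mathcal{L}(X)$. For an extendable language $L\subset S^*$, $\mathcal{L}^{-1}(L)$ is the unique subshift whose language is the set of all contiguous subwords of words of $L$. In regular expressions $+$ denotes union, so $0^*(1+2)0^*$ is the set of words $0^a s 0^b$ with $s\in\{1,2\}$, $a,b\geq 0$. For a finite set $C$ of words of a common length $n$, $[C]$ is the clopen set of points $x$ with $x_{[0,n-1]} \in C$; clopen sets are given in such a finite form (up to a shift of coordinates). The counting problem for $X$ is: given clopen sets $[C],[D],[E],[F]$ and a number $k$, decide whether there exist $x \in X$, $j \in \mathbb{N}=\{0,1,2,\dots\}$ and $A \subset [1,j-1]$ with $|A|=k$ such that $x \in [C]$, $\sigma^j(x)\in[D]$, $\sigma^i(x) \in [E]$ for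 all $i \in [1,j-1]\setminus A$, and $\sigma^i(x)\in[F]$ for all $i \in A$. Completeness is under many-one reductions. *)

theory Defs
  imports "HOL-Analysis.Analysis" "HOL-Library.Sublist" "HOL-Library.Nat_Bijection"
begin

section \<open>Recursive functions and many-one completeness\<close>

text \<open>
  Total recursive functions in Kleene's sense: the closure of the initial functions under
  composition, primitive recursion and minimisation of regular functions. A function of arity
  \<open>n\<close> takes a list of length \<open>n\<close>; its values on lists of other lengths carry no meaning.
\<close>

inductive recfn :: "nat \<Rightarrow> (nat list \<Rightarrow> nat) \<Rightarrow> bool" where
  zero_fn: "recfn n (\<lambda>_. 0)"
| succ_fn: "recfn 1 (\<lambda>xs. Suc (hd xs))"
| proj: "i < n \<Longrightarrow> recfn n (\<lambda>xs. xs ! i)"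
| comp: "recfn (length gs) f \<Longrightarrow> \<forall>g\<in>set gs. recfn n g \<Longrightarrow>
    recfn n (\<lambda>xs. f (map (\<lambda>g. g xs) gs))"
| prim_rec: "recfn n f \<Longrightarrow> recfn (Suc (Suc n)) g \<Longrightarrow>
    recfn (Suc n) (\<lambda>xs. rec_nat (f (tl xs)) (\<lambda>y r. g (y # r # tl xs)) (hd xs))"
| mu: "recfn (Suc n) f \<Longrightarrow> \<forall>xs. length xs = n \<longrightarrow> (\<exists>y. f (y # xs) = 0) \<Longrightarrow>
    recfn n (\<lambda>xs. LEAST y. f (y # xs) = 0)"

definition recursive_pred :: "nat \<Rightarrow> (nat list \<Rightarrow> bool) \<Rightarrow> bool" where
  "recursive_pred n P \<longleftrightarrow>
    (\<exists>f. recfn n f \<and> (\<forall>xs. length xs = n \<longrightarrow> f xs = (if P xs then 1 else 0)))"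

definition recursive_set :: "nat set \<Rightarrow> bool" where
  "recursive_set A \<longleftrightarrow> recursive_pred 1 (\<lambda>xs. xs ! 0 \<in> A)"

definition Sigma01 :: "nat set \<Rightarrow> bool" where
  "Sigma01 A \<longleftrightarrow>
    (\<exists>R. recursive_pred 2 (\<lambda>xs. R (xs ! 0) (xs ! 1)) \<and> A = {x. \<exists>y. R x y})"

definition many_one_reducible :: "nat set \<Rightarrow> nat set \<Rightarrow> bool" where
  "many_one_reducible A B \<longleftrightarrow> (\<exists>f. recfn 1 f \<and> (\<forall>x. x \<in> A \<longleftrightarrow> f [x] \<in> B))"

definition Sigma01_complete :: "nat set \<Rightarrow> bool" where
  "Sigma01_complete A \<longleftrightarrow> Sigma01 A \<and> (\<forall>B. Sigma01 B \<longrightarrow> many_one_reducible B A)"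


section \<open>Subshifts\<close>

definition lshift :: "(int \<Rightarrow> 'a) \<Rightarrow> int \<Rightarrow> 'a" where
  "lshift x = (\<lambda>i. x (i + 1))"

definition subshift :: "'a set \<Rightarrow> (int \<Rightarrow> 'a) set \<Rightarrow> bool" where
  "subshift S X \<longleftrightarrow>
    closedin (product_topology (\<lambda>_. discrete_topology S) UNIV) X \<and> lshift ` X = X"

definition subsystem :: "'a set \<Rightarrow> (int \<Rightarrow> 'a) set \<Rightarrow> (int \<Rightarrow> 'a) set \<Rightarrow> bool" where
  "subsystem S X Y \<longleftrightarrow> subshift S Y \<and> Y \<subseteq> X"

definition quasiminimal :: "'a set \<Rightarrow> (int \<Rightarrow> 'a) set \<Rightarrow> bool" where
  "quasiminimal S X \<longleftrightarrow> finite {Y. subsystem S X Y \<and> Y \<noteq> X}"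

definition window :: "(int \<Rightarrow> 'a) \<Rightarrow> int \<Rightarrow> nat \<Rightarrow> 'a list" where
  "window x i n = map (\<lambda>k. x (i + int k)) [0..<n]"

definition occurs_in :: "'a list \<Rightarrow> (int \<Rightarrow> 'a) \<Rightarrow> bool" where
  "occurs_in w x \<longleftrightarrow> (\<exists>i. window x i (length w) = w)"

definition language :: "(int \<Rightarrow> 'a) set \<Rightarrow> 'a list set" where
  "language X = {w. \<exists>x\<in>X. occurs_in w x}"

definition recursive_subshift :: "(int \<Rightarrow> nat) set \<Rightarrow> bool" where
  "recursive_subshift X \<longleftrightarrow> recursive_set (list_encode ` language X)"

definition weakly_transitive :: "(int \<Rightarrow> 'a) set \<Rightarrow> bool" where
  "weakly_transitive X \<longleftrightarrow> (\<exists>x\<in>X. \<forall>w\<in>language X. occurs_in w x)"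

definition factors :: "'a list set \<Rightarrow> 'a list set" where
  "factors L = {w. \<exists>v\<in>L. sublist w v}"

definition extendable :: "'a list set \<Rightarrow> bool" where
  "extendable L \<longleftrightarrow> (\<forall>w\<in>L. \<exists>u v. u \<noteq> [] \<and> v \<noteq> [] \<and> u @ w @ v \<in> L)"

text \<open>Meaningful for extendable \<open>L\<close> only; see \<open>lang_inv_unique\<close> below.\<close>

definition lang_inv :: "'a set \<Rightarrow> 'a list set \<Rightarrow> (int \<Rightarrow> 'a) set" where
  "lang_inv S L = (THE Y. subshift S Y \<and> language Y = factors L)"

lemma window_nth: "k < n \<Longrightarrow> window x i n ! k = x (i + int k)"
  by (simp add: window_def)

lemma length_window [simp]: "length (window x i n) = n"
  by (simp add: window_def)

lemma window_translate: "window (\<lambda>i. x (i + c)) i n = window x (i + c) n"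
  by (simp add: window_def algebra_simps)

lemma subshift_translate:
  assumes "subshift S X" "x \<in> X"
  shows "(\<lambda>i. x (i + c)) \<in> X"
proof -
  have eq: "lshift ` X = X" using assms by (simp add: subshift_def)
  have pos: "(\<lambda>i. y (i + int n)) \<in> X" if "y \<in> X" for n y
  proof (induction n)
    case 0 then show ?case using that by simp
  next
    case (Suc n)
    then have "lshift (\<lambda>i. y (i + int n)) \<in> X" using eq by blast
    then show ?case by (simp add: lshift_def algebra_simps)
  qed
  have neg: "(\<lambda>i. x (i - int n)) \<in> X" for n
  proof (induction n)
    case 0 then show ?case using assms by simp
  next
    case (Suc n)
    then obtain z where z: "z \<in> X" "(\<lambda>i. x (i - int n)) = lshift z" using eq by blast
    have "z i = x (i - int (Suc n))" for i
      using fun_cong [OF z(2), of "i - 1"] by (simp add: lshift_def algebra_simps)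
    then have "z = (\<lambda>i. x (i - int (Suc n)))" by blast
    then show ?case using z(1) by simp
  qed
  show ?thesis
  proof (cases "c \<ge> 0")
    case True then show ?thesis using pos [OF assms(2), of "nat c"] by simp
  next
    case False then show ?thesis using neg [of "nat (- c)"] by simp
  qed
qed

lemma subshift_range:
  assumes "subshift S X" "x \<in> X"
  shows "range x \<subseteq> S"
proof -
  have "X \<subseteq> topspace (product_topology (\<lambda>_::int. discrete_topology S) UNIV)"
    using assms(1) closedin_subset unfolding subshift_def by blast
  then show ?thesis using assms(2) by auto
qed

lemma subshift_eq_language:
  assumes "subshift S X"
  shows "X = {x. range x \<subseteq> S \<and> (\<forall>i n. window x i n \<in> language X)}"
proof (intro set_eqI iffI)
  fix x assume x: "x \<in> X"
  then have "range x \<subseteq> S" by (rule subshift_range [OF assms])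
  then show "x \<in> {x. range x \<subseteq> S \<and> (\<forall>i n. window x i n \<in> language X)}"
    using x by (auto simp: language_def occurs_in_def)
next
  fix x assume "x \<in> {x. range x \<subseteq> S \<and> (\<forall>i n. window x i n \<in> language X)}"
  then have rng: "range x \<subseteq> S" and lang: "\<And>i n. window x i n \<in> language X" by auto
  show "x \<in> X"
  proof (rule ccontr)
    assume "x \<notin> X"
    let ?T = "product_topology (\<lambda>_::int. discrete_topology S) UNIV"
    have "openin ?T (topspace ?T - X)" using assms by (simp add: subshift_def closedin_def)
    moreover have "x \<in> topspace ?T - X" using rng \<open>x \<notin> X\<close> by auto
    ultimately have "\<exists>U. finite {i \<in> UNIV. U i \<noteq> topspace (discrete_topology S)} \<and>
        (\<forall>i\<in>UNIV. openin (discrete_topology S) (U i)) \<and>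
        x \<in> Pi\<^sub>E UNIV U \<and> Pi\<^sub>E UNIV U \<subseteq> topspace ?T - X"
      by (simp only: openin_product_topology_alt)
    then obtain U where U: "finite {i. U i \<noteq> S}" "x \<in> PiE UNIV U"
      "PiE UNIV U \<subseteq> topspace ?T - X"
      by (elim exE conjE) (simp only: topspace_discrete_topology UNIV_I simp_thms)
    obtain b where b: "\<And>i. U i \<noteq> S \<Longrightarrow> \<bar>i\<bar> \<le> b"
    proof -
      have "finite (abs ` {i. U i \<noteq> S})" using U(1) by blast
      then show ?thesis
        by (intro that [of "Max (abs ` {i. U i \<noteq> S})"] Max_ge) auto
    qed
    define N where "N = nat \<bar>b\<bar>"
    obtain y i where y: "y \<in> X" "window y i (2 * N + 1) = window x (- int N) (2 * N + 1)"
      using lang [of "- int N" "2 * N + 1"] by (auto simp: language_def occurs_in_def)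
    define z where "z = (\<lambda>j. y (j + (i + int N)))"
    have zX: "z \<in> X" unfolding z_def by (rule subshift_translate [OF assms y(1)])
    then have "z j \<in> S" for j using subshift_range [OF assms] by blast
    moreover have "z j = x j" if "\<bar>j\<bar> \<le> b" for j
    proof -
      have *: "nat (j + int N) < 2 * N + 1" "int (nat (j + int N)) = j + int N"
        using that by (auto simp: N_def)
      show ?thesis
        using window_nth [OF *(1), of y i] window_nth [OF *(1), of x "- int N"] y(2) *(2)
        by (simp add: z_def algebra_simps)
    qed
    ultimately have "z j \<in> U j" for j
      using b [of j] U(2) by (cases "U j = S") auto
    then have "z \<in> PiE UNIV U" by auto
    then show False using U(3) zX by auto
  qed
qed

lemma subshift_of_words:
  "subshift S {x. range x \<subseteq> S \<and> (\<forall>i n. window x i n \<in> F)}" (is "subshift S ?Y")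
proof -
  let ?T = "product_topology (\<lambda>_::int. discrete_topology S) UNIV"
  have "openin ?T (topspace ?T - ?Y)"
    unfolding openin_product_topology_alt
  proof (intro ballI)
    fix x assume x: "x \<in> topspace ?T - ?Y"
    then have rng: "range x \<subseteq> S" by auto
    with x obtain i n where w: "window x i n \<notin> F" by auto
    define U where "U = (\<lambda>j. if i \<le> j \<and> j < i + int n then {x j} else S)"
    have "finite {j. U j \<noteq> S}"
      by (rule finite_subset [of _ "{i..<i + int n}"]) (auto simp: U_def)
    moreover have "U j \<subseteq> S" for j using rng by (auto simp: U_def)
    moreover have "x \<in> PiE UNIV U" using rng by (auto simp: U_def)
    moreover have "PiE UNIV U \<subseteq> topspace ?T - ?Y"
    proof
      fix y assume y: "y \<in> PiE UNIV U"
      then have yU: "y j \<in> U j" for j by auto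
      have "y j \<in> S" for j using yU [of j] rng by (auto simp: U_def split: if_splits)
      moreover have "y j = x j" if "i \<le> j" "j < i + int n" for j
        using yU [of j] that by (simp add: U_def)
      then have win: "window y i n = window x i n" by (simp add: window_def)
      moreover have "window y i n \<notin> F" using w win by simp
      ultimately have "range y \<subseteq> S" "y \<notin> ?Y" by blast+
      then show "y \<in> topspace ?T - ?Y" by auto
    qed
    ultimately show "\<exists>U. finite {i \<in> UNIV. U i \<noteq> topspace (discrete_topology S)} \<and>
        (\<forall>i\<in>UNIV. openin (discrete_topology S) (U i)) \<and>
        x \<in> Pi\<^sub>E UNIV U \<and> Pi\<^sub>E UNIV U \<subseteq> topspace ?T - ?Y"
      by (intro exI [of _ U]) (simp add: subset_iff)
  qed
  moreover have "?Y \<subseteq> topspace ?T" by auto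
  moreover have tr: "(\<lambda>i. x (i + c)) \<in> ?Y" if "x \<in> ?Y" for x c
    using that by (auto simp: window_translate)
  have "lshift ` ?Y = ?Y"
  proof (intro equalityI subsetI)
    fix x assume "x \<in> lshift ` ?Y"
    then show "x \<in> ?Y" using tr [of _ 1] unfolding lshift_def by blast
  next
    fix x assume "x \<in> ?Y"
    then have "(\<lambda>i. x (i - 1)) \<in> ?Y" using tr [of x "- 1"] by simp
    moreover have "x = lshift (\<lambda>i. x (i - 1))" by (simp add: lshift_def)
    ultimately show "x \<in> lshift ` ?Y" by blast
  qed
  ultimately show ?thesis by (simp add: subshift_def closedin_def)
qed

lemma extendable_point:
  assumes "extendable L" "v \<in> L"
  obtains x where "occurs_in v x" "\<And>i n. window x i n \<in> factors L"
proof -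
  obtain l r where lr: "\<And>w. w \<in> L \<Longrightarrow> l w \<noteq> [] \<and> r w \<noteq> [] \<and> l w @ w @ r w \<in> L"
    using assms(1) unfolding extendable_def by metis
  define W where "W = rec_nat v (\<lambda>_ w. l w @ w @ r w)"
  define P where "P = rec_nat 0 (\<lambda>n p. p + length (l (W n)))"
  have W_simps: "W 0 = v" "W (Suc n) = l (W n) @ W n @ r (W n)" for n by (simp_all add: W_def)
  have P_simps: "P 0 = 0" "P (Suc n) = P n + length (l (W n))" for n by (simp_all add: P_def)
  have WL: "W n \<in> L" for n by (induction n) (use assms(2) lr in \<open>auto simp: W_simps\<close>)
  have ne: "0 < length (l (W n))" "0 < length (r (W n))" for n using lr [OF WL] by auto
  have Pn: "n \<le> P n" for n
  proof (induction n)
    case (Suc n)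
    then show ?case using ne(1) [of n] by (simp only: P_simps)
  qed simp
  have Wn: "P n + n \<le> length (W n)" for n
  proof (induction n)
    case (Suc n)
    then show ?case using ne(2) [of n] by (simp add: W_simps P_simps Suc_le_eq del: length_greater_0_conv)
  qed (simp add: P_simps)
  define ok where "ok = (\<lambda>n i. - int (P n) \<le> i \<and> i < int (length (W n)) - int (P n))"
  define g where "g = (\<lambda>n i. W n ! nat (i + int (P n)))"
  have step: "ok (Suc n) i \<and> g (Suc n) i = g n i" if "ok n i" for n i
  proof -
    have "nat (i + int (P (Suc n))) = length (l (W n)) + nat (i + int (P n))"
      using that unfolding ok_def P_simps by linarith
    then show ?thesis using that
      by (auto simp: ok_def g_def W_simps P_simps nth_append)
  qed
  have mono: "ok (n + d) i \<and> g (n + d) i = g n i" if "ok n i" for n d i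
    by (induction d) (use that step in auto)
  have ok_abs: "ok (Suc (nat \<bar>i\<bar>)) i" for i
    using Pn [of "Suc (nat \<bar>i\<bar>)"] Wn [of "Suc (nat \<bar>i\<bar>)"] unfolding ok_def by linarith
  define x where "x = (\<lambda>i. g (Suc (nat \<bar>i\<bar>)) i)"
  have x: "x i = g n i" if "ok n i" for n i
    using mono [OF that, of "Suc (nat \<bar>i\<bar>)"] mono [OF ok_abs, of i n]
    by (simp add: x_def add.commute)
  have "window x 0 (length v) = v"
    by (rule nth_equalityI)
      (auto simp: window_nth x [of 0] ok_def g_def W_simps P_simps)
  then have "occurs_in v x" by (auto simp: occurs_in_def)
  moreover have "window x i n \<in> factors L" for i n
  proof -
    define N where "N = nat \<bar>i\<bar> + n"
    have rng: "ok N j" if "i \<le> j" "j < i + int n" for j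
      using that Pn [of N] Wn [of N] unfolding ok_def N_def by linarith
    define p where "p = nat (i + int (P N))"
    have p: "int p = i + int (P N)" "p + n \<le> length (W N)"
      using Pn [of N] Wn [of N] unfolding p_def N_def by linarith+
    have "window x i n = take n (drop p (W N))"
    proof (rule nth_equalityI)
      show "length (window x i n) = length (take n (drop p (W N)))" using p(2) by simp
      fix k assume "k < length (window x i n)"
      then have k: "k < n" by simp
      have "nat (i + int k + int (P N)) = p + k" using p(1) by simp
      then show "window x i n ! k = take n (drop p (W N)) ! k"
        using k p(2) rng [of "i + int k"] by (simp add: window_nth x [of N] g_def)
    qed
    then have "sublist (window x i n) (W N)"
      by (metis sublist_take sublist_drop sublist_order.order_trans)
    then show ?thesis using WL by (auto simp: factors_def)
  qed
  ultimately show thesis using that by blast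
qed

lemma occurs_in_sublist: "sublist w v \<Longrightarrow> occurs_in v x \<Longrightarrow> occurs_in w x"
proof -
  assume "sublist w v" "occurs_in v x"
  then obtain a b i where v: "v = a @ w @ b" and i: "window x i (length v) = v"
    by (auto simp: sublist_def occurs_in_def)
  have "window x (i + int (length a)) (length w) = w"
  proof (rule nth_equalityI)
    fix k assume "k < length (window x (i + int (length a)) (length w))"
    then have k: "k < length w" by simp
    have "window x i (length v) ! (length a + k) = w ! k" using k by (simp only: i) (simp add: v nth_append)
    then show "window x (i + int (length a)) (length w) ! k = w ! k"
      using k window_nth [of "length a + k" "length v" x i] by (simp add: window_nth v algebra_simps)
  qed simp
  then show "occurs_in w x" by (auto simp: occurs_in_def)
qed

lemma lang_inv_unique:
  assumes "extendable L" "L \<subseteq> lists S"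
  shows "\<exists>!Y. subshift S Y \<and> language Y = factors L"
proof
  let ?Y = "{x. range x \<subseteq> S \<and> (\<forall>i n. window x i n \<in> factors L)}"
  have "language ?Y = factors L"
  proof (intro equalityI subsetI)
    fix w assume "w \<in> language ?Y"
    then show "w \<in> factors L" by (auto simp: language_def occurs_in_def) metis
  next
    fix w assume "w \<in> factors L"
    then obtain v where v: "v \<in> L" "sublist w v" by (auto simp: factors_def)
    obtain x where x: "occurs_in v x" "\<And>i n. window x i n \<in> factors L"
      using extendable_point [OF assms(1) v(1)] by blast
    have "x i \<in> S" for i
    proof -
      have "window x i 1 \<in> factors L" by (rule x(2))
      then obtain u where "u \<in> L" "sublist [x i] u" by (auto simp: factors_def window_def)
      then show ?thesis using assms(2) by (auto simp: sublist_def)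
    qed
    then show "w \<in> language ?Y"
      using x occurs_in_sublist [OF v(2) x(1)] unfolding language_def by blast
  qed
  then show "subshift S ?Y \<and> language ?Y = factors L" using subshift_of_words by blast
  fix Y assume "subshift S Y \<and> language Y = factors L"
  then show "Y = ?Y" using subshift_eq_language [of S Y] by simp
qed

lemma lang_inv_eq:
  assumes "extendable L" "L \<subseteq> lists S"
  shows "lang_inv S L = {x. range x \<subseteq> S \<and> (\<forall>i n. window x i n \<in> factors L)}"
  using subshift_eq_language [of S "lang_inv S L"] theI' [OF lang_inv_unique [OF assms]]
  by (simp add: lang_inv_def)


section \<open>The counting problem\<close>

text \<open>
  A clopen set is presented by a pair \<open>(m, ws)\<close>: \<open>ws\<close> lists the finitely many words of a finite
  set \<open>C\<close>, and \<open>m\<close> is the coordinate at which they are read, so \<open>m = 0\<close> gives \<open>[C]\<close>.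
\<close>

type_synonym clopen = "int \<times> nat list list"

definition valid_clopen :: "nat set \<Rightarrow> clopen \<Rightarrow> bool" where
  "valid_clopen S c \<longleftrightarrow> (\<exists>n. \<forall>w\<in>set (snd c). length w = n \<and> set w \<subseteq> S)"

definition cylinder :: "clopen \<Rightarrow> (int \<Rightarrow> nat) set" where
  "cylinder c = {x. \<exists>w\<in>set (snd c). window x (fst c) (length w) = w}"

definition clopen_encode :: "clopen \<Rightarrow> nat" where
  "clopen_encode c =
    prod_encode (int_encode (fst c), list_encode (map list_encode (snd c)))"

definition counting_holds ::
  "(int \<Rightarrow> nat) set \<Rightarrow> clopen \<Rightarrow> clopen \<Rightarrow> clopen \<Rightarrow> clopen \<Rightarrow> nat \<Rightarrow> bool" where
  "counting_holds X C D E F k \<longleftrightarrow>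
    (\<exists>x\<in>X. \<exists>j::nat. \<exists>A \<subseteq> {1..<j}. card A = k \<and>
      x \<in> cylinder C \<and> (lshift ^^ j) x \<in> cylinder D \<and>
      (\<forall>i\<in>{1..<j} - A. (lshift ^^ i) x \<in> cylinder E) \<and>
      (\<forall>i\<in>A. (lshift ^^ i) x \<in> cylinder F))"

definition counting_problem :: "nat set \<Rightarrow> (int \<Rightarrow> nat) set \<Rightarrow> nat set" where
  "counting_problem S X =
    {list_encode [clopen_encode C, clopen_encode D, clopen_encode E, clopen_encode F, k] |C D E F k.
      valid_clopen S C \<and> valid_clopen S D \<and> valid_clopen S E \<and> valid_clopen S F \<and>
      counting_holds X C D E F k}"

end

theory Submission imports Defs begin

text \<open>
  Put letters on the squares: the point \<open>x0\<close> has the letter \<open>1\<close> or \<open>2\<close> at every square \<open>i\<^sup>2\<close> and \<open>0\<close>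
  everywhere else, and \<open>X\<close> is its orbit closure. The gaps between the marks grow, so a word with two
  marks occurs in \<open>x0\<close> only at finitely many places. Hence a limit of shifts of \<open>x0\<close> that is not itself
  a shift of \<open>x0\<close> has at most one mark (\<open>X_cases\<close>), so that \<open>X\<close> is countable. If both letters occur
  infinitely often, all the points with at most one mark are limits, and every proper subsystem consists of
  such points: it is determined by the letters that it contains (\<open>proper_subsystems_X\<close>), which leaves the
  four nonempty ones of the theorem. Moreover the place of a word with two marks is bounded in terms
  of its length, so a decidable choice of the letters makes the language decidable (\<open>recursive_X\<close>).

  The order of the letters is still free, and the counting problem can read it. With \<open>C = D = {2}\<close>,
  \<open>E = {0}\<close> and \<open>F = {1}\<close> it asks for two successive twos with exactly \<open>k\<close> ones between them
  (\<open>counting_letters_iff\<close>). Take a computable \<open>G\<close> whose range is a complete semi-recursive set, and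
  arrange the letters as \<open>2 1\<^bsup>G(0)+1\<^esup> 2 1\<^bsup>G(1)+1\<^esup> 2 \<dots>\<close>. Then the answer for \<open>k + 1\<close> is yes if and only if
  \<open>k\<close> is in the range of \<open>G\<close>, which gives hardness. The counting problem is semi-decidable because the
  points of \<open>X\<close> form a computable family indexed by codes, and all the data of a solution can be searched
  (\<open>Sigma01_counting_problem\<close>).

  Two pieces of recursion theory are developed for this. The first is a calculus of computable functions
  between types with a bijective coding by natural numbers; it reduces the recursiveness of each function that
  occurs to its syntactic shape. The second is the enumeration \<open>G\<close> (\<open>universal_enumeration\<close>). It
  needs no interpreter: the true statements ``program \<open>p\<close> yields \<open>ys\<close> on the input \<open>xs\<close>'' are the theorems of
  a small proof system, and a natural number codes a list of inferences that is carried out as far as the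
  inferences are justified.
\<close>

section \<open>Total recursive functions of several arguments\<close>

text \<open>
  The values of a recursive function on lists of the wrong length are artefacts of its derivation; this
  closure forgets them, which makes functions given by ordinary expressions available.
\<close>

definition total_rec :: "nat \<Rightarrow> (nat list \<Rightarrow> nat) \<Rightarrow> bool" where
  "total_rec n f \<longleftrightarrow> (\<exists>g. recfn n g \<and> (\<forall>xs. length xs = n \<longrightarrow> g xs = f xs))"

lemma total_recI: "recfn n g \<Longrightarrow> (\<And>xs. length xs = n \<Longrightarrow> g xs = f xs) \<Longrightarrow> total_rec n f"
  by (auto simp: total_rec_def)

lemma total_rec_cong:
  "total_rec n f \<Longrightarrow> (\<And>xs. length xs = n \<Longrightarrow> f xs = g xs) \<Longrightarrow> total_rec n g"
  by (auto simp: total_rec_def)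

lemma total_rec_zero: "total_rec n (\<lambda>_. 0)"
  by (rule total_recI [OF recfn.zero_fn]) simp

lemma total_rec_nth: "i < n \<Longrightarrow> total_rec n (\<lambda>xs. xs ! i)"
  by (rule total_recI [OF recfn.proj]) auto

lemma total_rec_comp:
  assumes "total_rec (length gs) f" "\<forall>g\<in>set gs. total_rec n g"
  shows "total_rec n (\<lambda>xs. f (map (\<lambda>g. g xs) gs))"
proof -
  obtain f' where f': "recfn (length gs) f'" "\<And>xs. length xs = length gs \<Longrightarrow> f' xs = f xs"
    using assms(1) by (auto simp: total_rec_def)
  have "\<forall>g\<in>set gs. \<exists>g'. recfn n g' \<and> (\<forall>xs. length xs = n \<longrightarrow> g' xs = g xs)"
    using assms(2) by (auto simp: total_rec_def)
  then obtain h where h: "\<forall>g\<in>set gs. recfn n (h g) \<and> (\<forall>xs. length xs = n \<longrightarrow> h g xs = g xs)"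
    by (rule bchoice [THEN exE])
  show ?thesis
  proof (rule total_recI)
    show "recfn n (\<lambda>xs. f' (map (\<lambda>g. g xs) (map h gs)))"
      using f' h by (intro recfn.comp) auto
    fix xs :: "nat list" assume "length xs = n"
    then have "map (\<lambda>g. g xs) (map h gs) = map (\<lambda>g. g xs) gs"
      using h by auto
    then show "f' (map (\<lambda>g. g xs) (map h gs)) = f (map (\<lambda>g. g xs) gs)"
      by (simp only: f'(2) length_map)
  qed
qed

lemma total_rec_comp1:
  "total_rec 1 (\<lambda>xs. h (xs ! 0)) \<Longrightarrow> total_rec n f \<Longrightarrow> total_rec n (\<lambda>xs. h (f xs))"
  using total_rec_comp [of "[f]" "\<lambda>xs. h (xs ! 0)" n] by simp

lemma total_rec_comp2:
  "total_rec 2 (\<lambda>xs. h (xs ! 0) (xs ! 1)) \<Longrightarrow> total_rec n f \<Longrightarrow> total_rec n g \<Longrightarrow>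
    total_rec n (\<lambda>xs. h (f xs) (g xs))"
  using total_rec_comp [of "[f, g]" "\<lambda>xs. h (xs ! 0) (xs ! 1)" n]
  by (simp add: numeral_2_eq_2)

text \<open>
  One parameter is enough: several parameters will be packed into one code.
\<close>

lemma total_rec_prim_rec:
  assumes "total_rec 1 (\<lambda>xs. f (xs ! 0))" "total_rec 3 (\<lambda>xs. g (xs ! 0) (xs ! 1) (xs ! 2))"
  shows "total_rec 2 (\<lambda>xs. rec_nat (f (xs ! 1)) (\<lambda>y r. g y r (xs ! 1)) (xs ! 0))"
proof -
  obtain f' where f': "recfn 1 f'" "\<And>x. f' [x] = f x"
    using assms(1) by (auto simp: total_rec_def)
  obtain g' where g': "recfn (Suc (Suc 1)) g'" "\<And>y r x. g' [y, r, x] = g y r x"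
    using assms(2) by (force simp: total_rec_def numeral_3_eq_3)
  show ?thesis
  proof (rule total_recI)
    show "recfn 2 (\<lambda>xs. rec_nat (f' (tl xs)) (\<lambda>y r. g' (y # r # tl xs)) (hd xs))"
      using recfn.prim_rec [OF f'(1) g'(1)] by (simp add: numeral_2_eq_2)
    fix xs :: "nat list" assume "length xs = 2"
    then obtain m x where "xs = [m, x]" by (auto simp: numeral_2_eq_2 length_Suc_conv)
    then show "rec_nat (f' (tl xs)) (\<lambda>y r. g' (y # r # tl xs)) (hd xs) =
        rec_nat (f (xs ! 1)) (\<lambda>y r. g y r (xs ! 1)) (xs ! 0)"
      by (simp add: f' g')
  qed
qed

lemma total_rec_mu:
  assumes "total_rec 2 (\<lambda>xs. h (xs ! 0) (xs ! 1))" "\<And>x. \<exists>y. h y x = 0"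
  shows "total_rec 1 (\<lambda>xs. LEAST y. h y (xs ! 0) = 0)"
proof -
  obtain h' where h': "recfn (Suc 1) h'" "\<And>y x. h' [y, x] = h y x"
    using assms(1) by (force simp: total_rec_def numeral_2_eq_2)
  show ?thesis
  proof (rule total_recI)
    show "recfn 1 (\<lambda>xs. LEAST y. h' (y # xs) = 0)"
      using assms(2) by (intro recfn.mu [OF h'(1)]) (auto simp: length_Suc_conv h'(2))
    fix xs :: "nat list" assume "length xs = 1"
    then show "(LEAST y. h' (y # xs) = 0) = (LEAST y. h y (xs ! 0) = 0)"
      by (auto simp: length_Suc_conv h'(2))
  qed
qed

lemma total_rec_Suc: "total_rec n f \<Longrightarrow> total_rec n (\<lambda>xs. Suc (f xs))"
proof (rule total_rec_comp1 [where h = Suc])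
  show "total_rec 1 (\<lambda>xs. Suc (xs ! 0))"
    by (rule total_recI [OF recfn.succ_fn]) (auto simp: length_Suc_conv)
qed

lemma total_rec_add: "total_rec n f \<Longrightarrow> total_rec n g \<Longrightarrow> total_rec n (\<lambda>xs. f xs + g xs)"
proof (rule total_rec_comp2 [where h = "(+)"])
  have "rec_nat b (\<lambda>_ r. Suc r) a = a + b" for a b by (induction a) auto
  then show "total_rec 2 (\<lambda>xs. xs ! 0 + xs ! 1)"
    using total_rec_prim_rec [of "\<lambda>x. x" "\<lambda>_ r _. Suc r"]
    by (simp add: total_rec_nth total_rec_Suc)
qed

lemma total_rec_mult: "total_rec n f \<Longrightarrow> total_rec n g \<Longrightarrow> total_rec n (\<lambda>xs. f xs * g xs)"
proof (rule total_rec_comp2 [where h = "(*)"])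
  have "rec_nat 0 (\<lambda>_ r. r + b) a = a * b" for a b by (induction a) auto
  then show "total_rec 2 (\<lambda>xs. xs ! 0 * xs ! 1)"
    using total_rec_prim_rec [of "\<lambda>_. 0" "\<lambda>_ r x. r + x"]
    by (simp add: total_rec_nth total_rec_zero total_rec_add)
qed

lemma total_rec_pred: "total_rec n f \<Longrightarrow> total_rec n (\<lambda>xs. f xs - 1)"
proof (rule total_rec_comp2 [where h = "\<lambda>x _. x - 1" and g = f])
  have "rec_nat 0 (\<lambda>y _. y) a = a - 1" for a by (induction a) auto
  then show "total_rec 2 (\<lambda>xs. xs ! 0 - 1)"
    using total_rec_prim_rec [of "\<lambda>_. 0" "\<lambda>y _ _. y"]
    by (simp add: total_rec_nth total_rec_zero)
qed

lemma total_rec_diff: "total_rec n f \<Longrightarrow> total_rec n g \<Longrightarrow> total_rec n (\<lambda>xs. f xs - g xs)"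
proof (rule total_rec_comp2 [where h = "\<lambda>a b. b - a"])
  have "rec_nat b (\<lambda>_ r. r - 1) a = b - a" for a b by (induction a) auto
  then show "total_rec 2 (\<lambda>xs. xs ! 1 - xs ! 0)"
    using total_rec_prim_rec [of "\<lambda>x. x" "\<lambda>_ r _. r - 1"]
    by (simp add: total_rec_nth total_rec_pred [simplified])
qed

lemma total_rec_triangle: "total_rec n f \<Longrightarrow> total_rec n (\<lambda>xs. triangle (f xs))"
proof (rule total_rec_comp2 [where h = "\<lambda>x _. triangle x" and g = f])
  have "rec_nat 0 (\<lambda>y r. r + Suc y) a = triangle a" for a by (induction a) auto
  then show "total_rec 2 (\<lambda>xs. triangle (xs ! 0))"
    using total_rec_prim_rec [of "\<lambda>_. 0" "\<lambda>y r _. r + Suc y"]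
    by (simp add: total_rec_nth total_rec_zero total_rec_add total_rec_Suc
        del: add_Suc_right)
qed

lemma total_rec_prod_encode:
  "total_rec n f \<Longrightarrow> total_rec n g \<Longrightarrow> total_rec n (\<lambda>xs. prod_encode (f xs, g xs))"
  by (simp add: prod_encode_def total_rec_add total_rec_triangle)

text \<open>
  The diagonal on which a code \<open>c\<close> lies is found by a search: it is the least \<open>s\<close> such that
  \<open>c\<close> comes before the triangular number of \<open>Suc s\<close>. The components of the pair are read off from it.
\<close>

definition diagonal :: "nat \<Rightarrow> nat" where
  "diagonal c = (LEAST s. Suc c - triangle (Suc s) = 0)"

lemma diagonal_prod_encode: "diagonal (prod_encode (a, b)) = a + b"
  unfolding diagonal_def
proof (rule Least_equality)
  show "Suc (prod_encode (a, b)) - triangle (Suc (a + b)) = 0"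
    by (simp add: prod_encode_def)
  fix s assume s: "Suc (prod_encode (a, b)) - triangle (Suc s) = 0"
  show "a + b \<le> s"
  proof (rule ccontr)
    assume "\<not> a + b \<le> s"
    then have "Suc s \<le> a + b" by simp
    have "mono triangle" by (rule incseq_SucI) simp
    then have "triangle (Suc s) \<le> triangle (a + b)" using \<open>Suc s \<le> a + b\<close> by (rule monoD)
    then show False using s by (simp add: prod_encode_def)
  qed
qed

lemma total_rec_diagonal: "total_rec n f \<Longrightarrow> total_rec n (\<lambda>xs. diagonal (f xs))"
proof (rule total_rec_comp1 [where h = diagonal])
  show "total_rec 1 (\<lambda>xs. diagonal (xs ! 0))"
    unfolding diagonal_def
  proof (rule total_rec_mu)
    show "total_rec 2 (\<lambda>xs. Suc (xs ! 1) - triangle (Suc (xs ! 0)))"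
      by (intro total_rec_diff total_rec_triangle total_rec_Suc total_rec_nth) auto
    show "\<exists>y. Suc x - triangle (Suc y) = 0" for x
      by (rule exI [of _ x]) simp
  qed
qed

lemma total_rec_fst: 
  assumes "total_rec n f" shows "total_rec n (\<lambda>xs. fst (prod_decode (f xs)))"
proof -
  have "fst (prod_decode c) = c - triangle (diagonal c)" for c
  proof -
    obtain a b where "c = prod_encode (a, b)" by (metis prod_decode_inverse surj_pair)
    then show ?thesis by (simp add: diagonal_prod_encode) (simp add: prod_encode_def)
  qed
  then show ?thesis using assms by (simp add: total_rec_diff total_rec_triangle total_rec_diagonal)
qed

lemma total_rec_snd: 
  assumes "total_rec n f" shows "total_rec n (\<lambda>xs. snd (prod_decode (f xs)))"
proof -
  have "snd (prod_decode c) = diagonal c - fst (prod_decode c)" for c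
  proof -
    obtain a b where "c = prod_encode (a, b)" by (metis prod_decode_inverse surj_pair)
    then show ?thesis by (simp add: diagonal_prod_encode)
  qed
  then show ?thesis using assms by (simp add: total_rec_diff total_rec_fst total_rec_diagonal)
qed


section \<open>Computable functions between coded types\<close>

text \<open>
  Every natural number is required to be a code, so that a search over all elements of the type is a
  search over the natural numbers. The instances extend the codings of pairs, lists and integers by which
  clopen sets and instances of the counting problem are presented.
\<close>

class coded =
  fixes enc :: "'a \<Rightarrow> nat"
  assumes bij_enc: "bij enc"

definition dec :: "nat \<Rightarrow> 'a::coded" where
  "dec = inv enc"

lemma dec_enc [simp]: "dec (enc a) = a"
  by (simp add: dec_def bij_enc bij_is_inj)

lemma enc_dec [simp]: "enc (dec n :: 'a::coded) = n"
  unfolding dec_def by (rule surj_f_inv_f [OF bij_is_surj [OF bij_enc]])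

lemma enc_eq_iff [simp]: "enc a = enc b \<longleftrightarrow> a = b"
  by (metis dec_enc)

instantiation nat :: coded
begin
definition enc_nat :: "nat \<Rightarrow> nat" where [simp]: "enc_nat n = n"
instance by standard (simp add: bij_def inj_def surj_def)
end

instantiation int :: coded
begin
definition enc_int :: "int \<Rightarrow> nat" where "enc_int = int_encode"
instance by standard (simp add: enc_int_def bij_int_encode)
end

instantiation prod :: (coded, coded) coded
begin
definition enc_prod :: "'a \<times> 'b \<Rightarrow> nat" where
  "enc_prod p = prod_encode (enc (fst p), enc (snd p))"
instance
proof
  show "bij (enc :: 'a \<times> 'b \<Rightarrow> nat)"
    by (rule o_bij [of "\<lambda>n. (dec (fst (prod_decode n)), dec (snd (prod_decode n)))"])
      (auto simp: enc_prod_def)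
qed
end

instantiation list :: (coded) coded
begin
definition enc_list :: "'a list \<Rightarrow> nat" where
  "enc_list xs = list_encode (map enc xs)"
instance
proof
  show "bij (enc :: 'a list \<Rightarrow> nat)"
    by (rule o_bij [of "\<lambda>n. map dec (list_decode n)"]) (auto simp: enc_list_def o_def)
qed
end

lemma dec_nat [simp]: "dec n = (n::nat)"
  using enc_dec [where 'a = nat, of n] by (simp del: enc_dec)

lemma enc_Pair: "enc (a, b) = prod_encode (enc a, enc b)"
  by (simp add: enc_prod_def)

lemma dec_prod: "dec (prod_encode (m, n)) = (dec m, dec n)"
proof -
  have "prod_encode (m, n) = enc (dec m :: 'a, dec n :: 'b)" by (simp add: enc_Pair)
  then show ?thesis by (simp only: dec_enc)
qed

lemma enc_Cons: "enc (a # as) = Suc (prod_encode (enc a, enc as))"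
  by (simp add: enc_list_def)

definition computable :: "('a::coded \<Rightarrow> 'b::coded) \<Rightarrow> bool" where
  "computable f \<longleftrightarrow> total_rec 1 (\<lambda>xs. enc (f (dec (xs ! 0))))"

lemma computableI:
  "total_rec 1 (\<lambda>xs. g (xs ! 0)) \<Longrightarrow> (\<And>a. enc (f a) = g (enc a)) \<Longrightarrow> computable f"
  unfolding computable_def by (erule total_rec_cong) simp

lemma computable_total_rec:
  assumes "computable f" "total_rec n (\<lambda>xs. enc (g xs))"
  shows "total_rec n (\<lambda>xs. enc (f (g xs)))"
  using total_rec_comp1 [OF assms(1) [unfolded computable_def] assms(2)] by simp

text \<open>
  Rules that decompose a goal along the syntax of a function. A function under a binder becomes a function
  of the pair of the bound variable and the outer argument, so no currying is involved.
\<close>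

named_theorems computable_intros

lemma computable_ident [computable_intros]: "computable (\<lambda>x. x)"
  by (rule computableI [where g = "\<lambda>n. n"]) (auto intro: total_rec_nth)

lemma computable_const [computable_intros]: "computable (\<lambda>_. c)"
proof -
  have "total_rec 1 (\<lambda>_. k)" for k
    by (induction k) (auto intro: total_rec_zero total_rec_Suc)
  then show ?thesis by (simp add: computable_def)
qed

lemma computable_compose:
  "computable g \<Longrightarrow> computable f \<Longrightarrow> computable (\<lambda>x. g (f x))"
  using computable_total_rec [of g 1 "\<lambda>xs. f (dec (xs ! 0))"] by (simp add: computable_def)

lemma computable_Pair [computable_intros]:
  "computable f \<Longrightarrow> computable g \<Longrightarrow> computable (\<lambda>x. (f x, g x))"
  unfolding computable_def by (simp add: enc_Pair total_rec_prod_encode)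

lemma computable_fst [computable_intros]: "computable f \<Longrightarrow> computable (\<lambda>x. fst (f x))"
  by (rule computable_compose [where g = fst])
    (auto intro!: computableI [OF total_rec_fst [OF total_rec_nth]] simp: enc_prod_def)

lemma computable_snd [computable_intros]: "computable f \<Longrightarrow> computable (\<lambda>x. snd (f x))"
  by (rule computable_compose [where g = snd])
    (auto intro!: computableI [OF total_rec_snd [OF total_rec_nth]] simp: enc_prod_def)

lemma computable_compose2:
  "computable (\<lambda>p. h (fst p) (snd p)) \<Longrightarrow> computable f \<Longrightarrow> computable g \<Longrightarrow>
    computable (\<lambda>x. h (f x) (g x))"
  using computable_compose [OF _ computable_Pair, of "\<lambda>p. h (fst p) (snd p)" f g] by simp

lemma computable_enc [computable_intros]: "computable f \<Longrightarrow> computable (\<lambda>x. enc (f x))"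
  by (simp add: computable_def)

lemma computable_dec [computable_intros]: "computable f \<Longrightarrow> computable (\<lambda>x. dec (f x))"
  by (simp add: computable_def)

lemma computable_Suc [computable_intros]: "computable f \<Longrightarrow> computable (\<lambda>x. Suc (f x))"
  by (simp add: computable_def total_rec_Suc)

lemma computable_add [computable_intros]:
  fixes f g :: "_ \<Rightarrow> nat"
  shows "computable f \<Longrightarrow> computable g \<Longrightarrow> computable (\<lambda>x. f x + g x)"
  by (simp add: computable_def total_rec_add)

lemma computable_mult [computable_intros]:
  fixes f g :: "_ \<Rightarrow> nat"
  shows "computable f \<Longrightarrow> computable g \<Longrightarrow> computable (\<lambda>x. f x * g x)"
  by (simp add: computable_def total_rec_mult)

lemma computable_diff [computable_intros]:
  fixes f g :: "_ \<Rightarrow> nat"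
  shows "computable f \<Longrightarrow> computable g \<Longrightarrow> computable (\<lambda>x. f x - g x)"
  by (simp add: computable_def total_rec_diff)

lemma computable_rec_nat [computable_intros]:
  fixes f :: "'a::coded \<Rightarrow> 'b::coded"
  assumes f: "computable f" and n: "computable n"
    and g: "computable (\<lambda>p. g (fst p) (fst (snd p)) (snd (snd p)))"
  shows "computable (\<lambda>x. rec_nat (f x) (\<lambda>m r. g m r x) (n x))"
proof (rule computable_compose2 [where h = "\<lambda>x n. rec_nat (f x) (\<lambda>m r. g m r x) n"])
  define F where "F = (\<lambda>a. enc (f (dec a)))"
  define G where "G = (\<lambda>m r a. enc (g m (dec r) (dec a)))"
  have F: "total_rec 1 (\<lambda>xs. F (xs ! 0))" using f by (simp add: F_def computable_def)
  have G: "total_rec 3 (\<lambda>xs. G (xs ! 0) (xs ! 1) (xs ! 2))"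
  proof -
    have "total_rec 3 (\<lambda>xs. enc (xs ! 0, dec (xs ! 1) :: 'b, dec (xs ! 2) :: 'a))"
      by (simp add: enc_Pair total_rec_prod_encode total_rec_nth)
    from computable_total_rec [OF g this] show ?thesis by (simp add: G_def)
  qed
  have eq: "rec_nat (F a) (\<lambda>m r. G m r a) k =
      enc (rec_nat (f (dec a)) (\<lambda>m r. g m r (dec a)) k)" for a k
    by (induction k) (simp_all add: F_def G_def)
  show "computable (\<lambda>p. rec_nat (f (fst p)) (\<lambda>m r. g m r (fst p)) (snd p))"
  proof (rule computableI)
    show "total_rec 1 (\<lambda>xs. rec_nat (F (fst (prod_decode (xs ! 0))))
        (\<lambda>m r. G m r (fst (prod_decode (xs ! 0)))) (snd (prod_decode (xs ! 0))))"
      by (rule total_rec_comp2 [OF total_rec_prim_rec [OF F G]])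
        (intro total_rec_fst total_rec_snd total_rec_nth, simp)+
  qed (simp add: eq enc_prod_def)
qed (use n computable_ident in auto)

lemma computable_Least:
  fixes h :: "nat \<Rightarrow> 'a::coded \<Rightarrow> nat"
  assumes h: "computable (\<lambda>p. h (fst p) (snd p))" and ex: "\<And>x. \<exists>y. h y x = 0"
  shows "computable (\<lambda>x. LEAST y. h y x = 0)"
proof -
  have "total_rec 2 (\<lambda>xs. enc (xs ! 0, dec (xs ! 1) :: 'a))"
    by (simp add: enc_Pair total_rec_prod_encode total_rec_nth)
  from computable_total_rec [OF h this]
  have "total_rec 2 (\<lambda>xs. h (xs ! 0) (dec (xs ! 1)))" by simp
  from total_rec_mu [OF this ex] show ?thesis by (simp add: computable_def)
qed

definition decidable :: "('a::coded \<Rightarrow> bool) \<Rightarrow> bool" where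
  "decidable P \<longleftrightarrow> computable (\<lambda>x. of_bool (P x) :: nat)"

lemma computable_of_bool [computable_intros]: "decidable P \<Longrightarrow> computable (\<lambda>x. of_bool (P x) :: nat)"
  by (simp add: decidable_def)

text \<open>
  A case distinction is a recursion with one round or none.
\<close>

lemma computable_if [computable_intros]:
  assumes "decidable P" "computable f" "computable g"
  shows "computable (\<lambda>x. if P x then f x else g x)"
proof -
  have "computable (\<lambda>x. rec_nat (g x) (\<lambda>m r. f x) (of_bool (P x)))"
    using assms
    by (intro computable_intros computable_compose [where f = "\<lambda>p. snd (snd p)" and g = f])
  moreover have "rec_nat (g x) (\<lambda>m r. f x) (of_bool (P x)) = (if P x then f x else g x)" for x
    by simp
  ultimately show ?thesis by simp
qed

lemma decidable_compose: "decidable P \<Longrightarrow> computable f \<Longrightarrow> decidable (\<lambda>x. P (f x))"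
  unfolding decidable_def by (rule computable_compose)

lemma decidable_const [computable_intros]: "decidable (\<lambda>_. b)"
  unfolding decidable_def by (rule computable_const)

lemma decidable_not [computable_intros]:
  assumes "decidable P" shows "decidable (\<lambda>x. \<not> P x)"
proof -
  have "of_bool (\<not> P x) = 1 - (of_bool (P x) :: nat)" for x by simp
  then show ?thesis
    unfolding decidable_def using assms by (simp only: computable_intros)
qed

lemma decidable_conj [computable_intros]:
  "decidable P \<Longrightarrow> decidable Q \<Longrightarrow> decidable (\<lambda>x. P x \<and> Q x)"
  using computable_mult [of "\<lambda>x. of_bool (P x)" "\<lambda>x. of_bool (Q x)"]
  by (simp add: decidable_def of_bool_conj)

lemma decidable_disj [computable_intros]:
  "decidable P \<Longrightarrow> decidable Q \<Longrightarrow> decidable (\<lambda>x. P x \<or> Q x)"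
  using decidable_not [OF decidable_conj [OF decidable_not decidable_not], of P Q] by simp

lemma decidable_imp [computable_intros]:
  "decidable P \<Longrightarrow> decidable Q \<Longrightarrow> decidable (\<lambda>x. P x \<longrightarrow> Q x)"
  unfolding imp_conv_disj by (intro computable_intros)

lemma decidable_if [computable_intros]:
  "decidable P \<Longrightarrow> decidable Q \<Longrightarrow> decidable R \<Longrightarrow> decidable (\<lambda>x. if P x then Q x else R x)"
  unfolding if_bool_eq_conj by (intro computable_intros)

lemma decidable_le [computable_intros]:
  fixes f g :: "_ \<Rightarrow> nat"
  assumes "computable f" "computable g"
  shows "decidable (\<lambda>x. f x \<le> g x)"
proof -
  have "of_bool (f x \<le> g x) = 1 - (f x - g x)" for x by auto
  then show ?thesis unfolding decidable_def using assms by (simp add: computable_intros)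
qed

lemma decidable_less [computable_intros]:
  fixes f g :: "_ \<Rightarrow> nat"
  assumes "computable f" "computable g"
  shows "decidable (\<lambda>x. f x < g x)"
  unfolding less_eq_Suc_le using assms by (intro computable_intros)

lemma decidable_eq [computable_intros]:
  assumes "computable f" "computable g"
  shows "decidable (\<lambda>x. f x = g x)"
proof -
  have "f x = g x \<longleftrightarrow> enc (f x) \<le> enc (g x) \<and> enc (g x) \<le> enc (f x)" for x
    by (metis enc_eq_iff order_antisym order_refl)
  then show ?thesis using assms by (simp add: computable_intros)
qed

subsection \<open>Lists\<close>

lemma computable_Cons [computable_intros]:
  "computable f \<Longrightarrow> computable g \<Longrightarrow> computable (\<lambda>x. f x # g x)"
  unfolding computable_def by (simp add: enc_Cons total_rec_Suc total_rec_prod_encode)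

lemma computable_hd [computable_intros]:
  assumes "computable f" shows "computable (\<lambda>x. hd (f x) :: 'a::coded)"
proof -
  have "computable (\<lambda>l. if l = [] then hd [] else fst (dec (enc l - 1) :: 'a \<times> 'a list))"
    by (intro computable_intros)
  moreover have "(\<lambda>l. if l = [] then hd [] else fst (dec (enc l - 1) :: 'a \<times> 'a list)) = hd"
    by (rule ext) (auto simp: neq_Nil_conv enc_Cons dec_prod)
  ultimately have "computable (hd :: 'a list \<Rightarrow> _)" by (rule back_subst)
  then show ?thesis using assms by (rule computable_compose)
qed

lemma computable_tl [computable_intros]:
  assumes "computable f" shows "computable (\<lambda>x. tl (f x) :: 'a::coded list)"
proof -
  have "computable (\<lambda>l. if l = [] then [] else snd (dec (enc l - 1) :: 'a \<times> 'a list))"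
    by (intro computable_intros)
  moreover have "(\<lambda>l. if l = [] then [] else snd (dec (enc l - 1) :: 'a \<times> 'a list)) = tl"
    by (rule ext) (auto simp: neq_Nil_conv enc_Cons dec_prod)
  ultimately have "computable (tl :: 'a list \<Rightarrow> _)" by (rule back_subst)
  then show ?thesis using assms by (rule computable_compose)
qed

lemma length_le_enc: "length l \<le> enc l"
proof (induction l)
  case (Cons a l)
  then show ?case using le_prod_encode_2 [of "enc l" "enc a"] by (simp add: enc_Cons)
qed simp

text \<open>
  A fold consumes its list one entry per round, and the code of a list bounds its length; so running
  as many rounds as the code says, with idle rounds on the empty list, is primitive recursion.
\<close>

lemma computable_foldl:
  fixes l :: "'x::coded \<Rightarrow> 'a::coded list" and init :: "'x \<Rightarrow> 'b::coded"
  assumes step: "computable (\<lambda>p. step (fst p) (fst (snd p)) (snd (snd p)))"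
    and init: "computable init" and l: "computable l"
  shows "computable (\<lambda>x. foldl (\<lambda>b a. step b a x) (init x) (l x))"
proof -
  \<comment> \<open>A round moves the head of the remaining list into the accumulated value.\<close>
  define next_st where "next_st = (\<lambda>x (s :: 'b \<times> 'a list).
    if snd s = [] then s else (step (fst s) (hd (snd s)) x, tl (snd s)))"
  define run where "run = (\<lambda>x. rec_nat (init x, l x) (\<lambda>_ s. next_st x s))"
  have "computable (\<lambda>p. step (fst (f p)) (hd (snd (f p))) (g p))"
    if "computable f" "computable g" for f :: "'y::coded \<Rightarrow> 'b \<times> 'a list" and g :: "'y \<Rightarrow> 'x"
    using computable_compose [OF step, of "\<lambda>p. (fst (f p), hd (snd (f p)), g p)"] that
    by (simp add: computable_intros)
  note step' = this
  have "computable (\<lambda>x. run x (enc (l x)))"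
    unfolding run_def next_st_def using init l by (intro computable_intros step')
  moreover have "fst (run x (enc (l x))) = foldl (\<lambda>b a. step b a x) (init x) (l x)" for x
  proof -
    have aux: "fst (rec_nat s (\<lambda>_ s. next_st x s) n) = foldl (\<lambda>b a. step b a x) (fst s) (snd s)"
      if "length (snd s) \<le> n" for s n
    proof -
      have rec: "rec_nat s (\<lambda>_ s. next_st x s) (Suc n) = rec_nat (next_st x s) (\<lambda>_ s. next_st x s) n" for s n
        by (induction n) auto
      show ?thesis using that
      proof (induction n arbitrary: s)
        case (Suc n)
        show ?case
        proof (cases "snd s")
          case Nil
          then show ?thesis using Suc.IH [of s] by (simp only: rec) (simp add: next_st_def)
        next
          case (Cons a t)
          then show ?thesis
            using Suc.IH [of "next_st x s"] Suc.prems by (simp only: rec) (simp add: next_st_def)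
        qed
      qed simp
    qed
    show ?thesis unfolding run_def using aux [of "(init x, l x)"] length_le_enc [of "l x"] by simp
  qed
  ultimately show ?thesis using computable_fst by fastforce
qed

lemma computable_rev [computable_intros]:
  fixes l :: "'a::coded \<Rightarrow> 'b::coded list"
  shows "computable l \<Longrightarrow> computable (\<lambda>x. rev (l x))"
proof -
  have "foldl (\<lambda>b a. a # b) t l = rev l @ t" for t l :: "'b list"
    by (induction l arbitrary: t) auto
  then show "computable l \<Longrightarrow> computable (\<lambda>x. rev (l x))"
    using computable_foldl [where step = "\<lambda>b a _. a # b" and init = "\<lambda>_. []" and l = l]
    by (simp add: computable_intros)
qed

lemma computable_append [computable_intros]:
  fixes l l' :: "'a::coded \<Rightarrow> 'b::coded list"
  shows "computable l \<Longrightarrow> computable l' \<Longrightarrow> computable (\<lambda>x. l x @ l' x)"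
proof -
  have "foldl (\<lambda>b a. a # b) t (rev l) = l @ t" for t l :: "'b list"
    by (induction l arbitrary: t) auto
  then show "computable l \<Longrightarrow> computable l' \<Longrightarrow> computable (\<lambda>x. l x @ l' x)"
    using computable_foldl [where step = "\<lambda>b a _. a # b" and init = l' and l = "\<lambda>x. rev (l x)"]
    by (simp add: computable_intros)
qed

lemma computable_map [computable_intros]:
  assumes "computable (\<lambda>p. f (fst p) (snd p))" "computable l"
  shows "computable (\<lambda>x. map (\<lambda>a. f a x) (l x))"
proof -
  have "foldl (\<lambda>b a. b @ [f a x]) t l = t @ map (\<lambda>a. f a x) l" for x t l
    by (induction l arbitrary: t) auto
  moreover have "computable (\<lambda>p. f (fst (snd p)) (snd (snd p)))"
    using computable_compose [OF assms(1) computable_snd [OF computable_ident]] .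
  then have "computable (\<lambda>x. foldl (\<lambda>b a. b @ [f a x]) [] (l x))"
    using assms(2) by (intro computable_foldl computable_intros)
  ultimately show ?thesis by simp
qed

lemma computable_filter [computable_intros]:
  assumes "decidable (\<lambda>p. P (fst p) (snd p))" "computable l"
  shows "computable (\<lambda>x. filter (\<lambda>a. P a x) (l x))"
proof -
  have "foldl (\<lambda>b a. if P a x then b @ [a] else b) t l = t @ filter (\<lambda>a. P a x) l" for x t l
    by (induction l arbitrary: t) auto
  moreover have "decidable (\<lambda>p. P (fst (snd p)) (snd (snd p)))"
    using decidable_compose [OF assms(1) computable_snd [OF computable_ident]] .
  then have "computable (\<lambda>x. foldl (\<lambda>b a. if P a x then b @ [a] else b) [] (l x))"
    using assms(2) by (intro computable_foldl computable_intros)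
  ultimately show ?thesis by simp
qed

lemma computable_length [computable_intros]:
  fixes l :: "'a::coded \<Rightarrow> 'b::coded list"
  shows "computable l \<Longrightarrow> computable (\<lambda>x. length (l x))"
proof -
  have "foldl (\<lambda>b a. Suc b) t l = length l + t" for t and l :: "'b list"
    by (induction l arbitrary: t) auto
  then show "computable l \<Longrightarrow> computable (\<lambda>x. length (l x))"
    using computable_foldl [where step = "\<lambda>b a _. Suc b" and init = "\<lambda>_. 0" and l = l]
    by (simp add: computable_intros)
qed

lemma decidable_Ball_set [computable_intros]:
  assumes "decidable (\<lambda>p. P (fst p) (snd p))" "computable l"
  shows "decidable (\<lambda>x. \<forall>a\<in>set (l x). P a x)"
proof -
  have "(\<forall>a\<in>set (l x). P a x) \<longleftrightarrow> filter (\<lambda>a. \<not> P a x) (l x) = []" for x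
    by (auto simp: filter_empty_conv)
  moreover have "decidable (\<lambda>x. filter (\<lambda>a. \<not> P a x) (l x) = [])"
    using assms by (intro computable_intros)
  ultimately show ?thesis by presburger
qed

lemma decidable_Bex_set [computable_intros]:
  assumes "decidable (\<lambda>p. P (fst p) (snd p))" "computable l"
  shows "decidable (\<lambda>x. \<exists>a\<in>set (l x). P a x)"
  using decidable_not [OF decidable_Ball_set [OF decidable_not [OF assms(1)] assms(2)]] by simp

lemma decidable_mem_set [computable_intros]:
  assumes "computable f" "computable l"
  shows "decidable (\<lambda>x. f x \<in> set (l x))"
proof -
  have "decidable (\<lambda>x. \<exists>a\<in>set (l x). a = f x)"
    using assms by (intro computable_intros computable_compose [where f = snd and g = f])
  then show ?thesis by simp
qed

lemma computable_upt [computable_intros]: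
  assumes "computable m" "computable n"
  shows "computable (\<lambda>x. [m x..<n x])"
proof -
  have 0: "rec_nat [] (\<lambda>i r. r @ [i]) b = [0..<b]" for b by (induction b) auto
  have "filter ((\<le>) a) [0..<b] = [a..<b]" for a b
    by (induction b) auto
  then have "[m x..<n x] = filter (\<lambda>i. m x \<le> i) (rec_nat [] (\<lambda>i r. r @ [i]) (n x))" for x
    by (simp add: 0)
  then show ?thesis
    using assms by (simp add: computable_intros computable_compose [where f = snd and g = m])
qed

subsection \<open>Integers\<close>

text \<open>
  Nonnegative integers have even codes and negative integers have odd ones; halving is a search.
\<close>

lemma computable_nat [computable_intros]:
  assumes "computable f" shows "computable (\<lambda>x. nat (f x))"
proof -
  define h where "h = (\<lambda>e. if \<exists>j\<in>set [0..<e]. e = Suc (2 * j) then 0 else LEAST j :: nat. e - 2 * j = 0)"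
  have "computable h"
    unfolding h_def by (intro computable_intros computable_Least) (metis diff_is_0_eq' le_add2 mult_2)
  moreover have "nat i = h (enc i)" for i :: int
  proof (cases "0 \<le> i")
    case True
    then have e: "enc i = 2 * nat i" by (simp add: enc_int_def int_encode_def sum_encode_def)
    have "(LEAST j. 2 * nat i - 2 * j = 0) = nat i" by (rule Least_equality) auto
    moreover have "2 * n \<noteq> Suc (2 * j)" for n j :: nat by presburger
    ultimately show ?thesis unfolding h_def e by simp
  next
    case False
    then have "enc i = Suc (2 * nat (- i - 1))" by (simp add: enc_int_def int_encode_def sum_encode_def)
    then have "h (enc i) = 0" by (auto simp: h_def)
    then show ?thesis using False by simp
  qed
  ultimately show ?thesis using assms by (simp add: computable_intros computable_compose [where g = h])
qed

lemma computable_int_diff [computable_intros]: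
  fixes m n :: "'a::coded \<Rightarrow> nat"
  assumes "computable m" "computable n" shows "computable (\<lambda>x. int (m x) - int (n x))"
proof -
  have "enc (int a - int b) = (if b \<le> a then 2 * (a - b) else Suc (2 * (b - a - 1)))" for a b :: nat
    by (auto simp: enc_int_def int_encode_def sum_encode_def)
  then have "int a - int b = dec (if b \<le> a then 2 * (a - b) else Suc (2 * (b - a - 1)))" for a b :: nat
    by (metis dec_enc)
  then show ?thesis using assms by (simp only: computable_intros)
qed

lemma computable_nat_uminus:
  assumes "computable f" shows "computable (\<lambda>x. nat (- f x))"
proof -
  define h where "h = (\<lambda>e. if \<exists>j\<in>set [0..<e]. e = Suc (2 * j) then Suc (LEAST j :: nat. e - Suc (2 * j) = 0) else 0)"
  have "computable h"
    unfolding h_def by (intro computable_intros computable_Least) (metis diff_is_0_eq' le_add2 le_SucI mult_2)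
  moreover have "nat (- i) = h (enc i)" for i :: int
  proof (cases "0 \<le> i")
    case True
    then have e: "enc i = 2 * nat i" by (simp add: enc_int_def int_encode_def sum_encode_def)
    have "2 * n \<noteq> Suc (2 * j)" for n j :: nat by presburger
    then show ?thesis unfolding h_def e using True by simp
  next
    case False
    then have e: "enc i = Suc (2 * nat (- i - 1))" by (simp add: enc_int_def int_encode_def sum_encode_def)
    have "(LEAST j. Suc (2 * nat (- i - 1)) - Suc (2 * j) = 0) = nat (- i - 1)"
      by (rule Least_equality) auto
    moreover have "\<exists>j\<in>set [0..<enc i]. enc i = Suc (2 * j)" unfolding e by force
    ultimately show ?thesis using False unfolding h_def by (simp add: e)
  qed
  ultimately show ?thesis using assms by (simp add: computable_intros computable_compose [where g = h])
qed

lemma computable_int_add [computable_intros]: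
  fixes f g :: "'a::coded \<Rightarrow> int"
  assumes "computable f" "computable g" shows "computable (\<lambda>x. f x + g x)"
proof -
  have "i + j = int (nat i + nat j) - int (nat (- i) + nat (- j))" for i j by simp
  then show ?thesis using assms
    by (simp only:) (intro computable_intros computable_nat_uminus)
qed

lemma computable_int [computable_intros]:
  fixes m :: "'a::coded \<Rightarrow> nat"
  assumes "computable m" shows "computable (\<lambda>x. int (m x))"
  using computable_int_diff [OF assms computable_const, of 0] by simp

subsection \<open>Recursive and semi-recursive sets\<close>

lemma recfn_of_computable:
  fixes f :: "nat \<Rightarrow> nat"
  assumes "computable f" obtains g where "recfn 1 g" "\<And>x. g [x] = f x"
  using assms by (auto simp: computable_def total_rec_def)

lemma recursive_set_of_decidable: 
  assumes "decidable (\<lambda>n. n \<in> A)" shows "recursive_set A"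
proof -
  obtain g where g: "recfn 1 g" "\<And>x. g [x] = of_bool (x \<in> A)"
    using assms recfn_of_computable unfolding decidable_def by metis
  then show ?thesis unfolding recursive_set_def recursive_pred_def
    by (intro exI [of _ g]) (auto simp: length_Suc_conv)
qed

text \<open>
  The witness may be of any coded type, for instance a tuple of lists.
\<close>

lemma Sigma01_of_decidable:
  fixes P :: "nat \<Rightarrow> 'a::coded \<Rightarrow> bool"
  assumes "decidable (\<lambda>p. P (fst p) (snd p))" shows "Sigma01 {x. \<exists>a. P x a}"
proof -
  have "total_rec 2 (\<lambda>xs. enc (xs ! 0, dec (xs ! 1) :: 'a))"
    by (simp add: enc_Pair total_rec_prod_encode total_rec_nth)
  from computable_total_rec [OF assms [unfolded decidable_def] this]
  obtain g where g: "recfn 2 g" "\<And>xs. length xs = 2 \<Longrightarrow> g xs = of_bool (P (xs ! 0) (dec (xs ! 1)))"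
    by (auto simp: total_rec_def)
  have "recursive_pred 2 (\<lambda>xs. P (xs ! 0) (dec (xs ! 1)))"
    unfolding recursive_pred_def by (intro exI [of _ g]) (auto simp: g)
  moreover have "{x. \<exists>a. P x a} = {x. \<exists>y. P x (dec y)}"
    by (metis dec_enc)
  ultimately show ?thesis unfolding Sigma01_def by (intro exI [of _ "\<lambda>x y. P x (dec y)"]) simp
qed

section \<open>A universal semi-recursive set\<close>

text \<open>
  Programs take lists to lists. A program is the code of a triple that consists of a tag and two
  subprograms, where a missing subprogram is \<open>0\<close>. Numerical values are lists of length one.
\<close>

abbreviation P_zero where "P_zero \<equiv> enc (0::nat, 0::nat, 0::nat)"
abbreviation P_succ where "P_succ \<equiv> enc (1::nat, 0::nat, 0::nat)"
abbreviation P_head where "P_head \<equiv> enc (2::nat, 0::nat, 0::nat)"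
abbreviation P_tail where "P_tail \<equiv> enc (3::nat, 0::nat, 0::nat)"
abbreviation P_empty where "P_empty \<equiv> enc (4::nat, 0::nat, 0::nat)"
abbreviation P_cons where "P_cons p q \<equiv> enc (5::nat, p::nat, q::nat)"
abbreviation P_comp where "P_comp p q \<equiv> enc (6::nat, p::nat, q::nat)"
abbreviation P_rec where "P_rec p q \<equiv> enc (7::nat, p::nat, q::nat)"
abbreviation P_mu where "P_mu p \<equiv> enc (8::nat, p::nat, 0::nat)"

text \<open>
  The rule for minimisation asks only that the results below the minimum differ from \<open>[0]\<close>; together
  with determinism this says that the search does not stop earlier.
\<close>

inductive yields :: "nat \<Rightarrow> nat list \<Rightarrow> nat list \<Rightarrow> bool" where
  yields_zero: "yields P_zero xs [0]"
| yields_succ: "yields P_succ (x # xs) [Suc x]"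
| yields_head: "yields P_head (x # xs) [x]"
| yields_tail: "yields P_tail (x # xs) xs"
| yields_empty: "yields P_empty xs []"
| yields_cons: "yields p xs [y] \<Longrightarrow> yields q xs ys \<Longrightarrow> yields (P_cons p q) xs (y # ys)"
| yields_comp: "yields q xs zs \<Longrightarrow> yields p zs ys \<Longrightarrow> yields (P_comp p q) xs ys"
| yields_rec_0: "yields p xs ys \<Longrightarrow> yields (P_rec p q) (0 # xs) ys"
| yields_rec_Suc: "yields (P_rec p q) (n # xs) [r] \<Longrightarrow> yields q (n # r # xs) ys \<Longrightarrow>
    yields (P_rec p q) (Suc n # xs) ys"
| yields_mu: "yields p (m # xs) [0] \<Longrightarrow> \<forall>z<m. \<exists>ys. ys \<noteq> [0] \<and> yields p (z # xs) ys \<Longrightarrow> yields (P_mu p) xs [m]"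

text \<open>
  Determinism turns the existence of a derivation with a given output into a statement about the value of the
  function. In the case of minimisation, two different results would give the smaller one the
  output \<open>[0]\<close> in one derivation and another output in the other.
\<close>

lemma yields_deterministic: "yields p xs ys \<Longrightarrow> yields p xs ys' \<Longrightarrow> ys' = ys"
proof (induction p xs ys arbitrary: ys' rule: yields.induct)
  case (yields_mu p m xs)
  from yields_mu.prems obtain m' where m': "ys' = [m']" "yields p (m' # xs) [0]"
      "\<forall>z<m'. \<exists>ys. ys \<noteq> [0] \<and> yields p (z # xs) ys"
    by cases auto
  consider "m' < m" | "m' = m" | "m < m'" by linarith
  then show ?case
  proof cases
    case 1
    then show ?thesis using yields_mu.IH(2) m'(2) by blast
  next
    case 3
    then show ?thesis using yields_mu.IH(1) m'(3) by blast
  qed (use m' in simp)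
next
  case (yields_cons p xs y q ys)
  from yields_cons.prems show ?case by cases (use yields_cons.IH in auto)
next
  case (yields_comp q xs zs p ys)
  from yields_comp.prems show ?case by cases (use yields_comp.IH in auto)
next
  case (yields_rec_0 p xs ys q)
  from yields_rec_0.prems show ?case by cases (use yields_rec_0.IH in auto)
next
  case (yields_rec_Suc p q n xs r ys)
  from yields_rec_Suc.prems show ?case by cases (use yields_rec_Suc.IH in auto)
qed (erule yields.cases; simp)+

subsection \<open>Every recursive function has a program\<close>

definition computes :: "nat \<Rightarrow> nat \<Rightarrow> (nat list \<Rightarrow> nat) \<Rightarrow> bool" where
  "computes p n f \<longleftrightarrow> (\<forall>xs. length xs = n \<longrightarrow> yields p xs [f xs])"

lemma computes_nth: "i < n \<Longrightarrow> \<exists>p. computes p n (\<lambda>xs. xs ! i)"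
proof (induction i arbitrary: n)
  case 0
  then have "computes P_head n (\<lambda>xs. xs ! 0)"
    by (auto simp: computes_def neq_Nil_conv length_greater_0_conv [symmetric] simp del: length_greater_0_conv
        intro: yields_head) (metis yields_head length_greater_0_conv list.exhaust nth_Cons_0)
  then show ?case ..
next
  case (Suc i)
  then obtain n' where n': "n = Suc n'" "i < n'" by (metis less_Suc_eq_0_disj Suc_less_eq2)
  with Suc.IH obtain p where p: "computes p n' (\<lambda>xs. xs ! i)" by blast
  have "computes (P_comp p P_tail) n (\<lambda>xs. xs ! Suc i)"
    using p unfolding computes_def n' by (auto simp: length_Suc_conv intro!: yields_comp [OF yields_tail])
  then show ?case ..
qed

lemma computes_map:
  assumes "\<And>g. g \<in> set gs \<Longrightarrow> \<exists>p. computes p n g"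
  shows "\<exists>p. \<forall>xs. length xs = n \<longrightarrow> yields p xs (map (\<lambda>g. g xs) gs)"
  using assms
proof (induction gs)
  case Nil
  show ?case using yields_empty by (intro exI [of _ P_empty]) simp
next
  case (Cons g gs)
  obtain p where p: "computes p n g" using Cons.prems by force
  obtain q where "\<forall>xs. length xs = n \<longrightarrow> yields q xs (map (\<lambda>g. g xs) gs)"
    using Cons by force
  then show ?case using p yields_cons unfolding computes_def by (intro exI [of _ "P_cons p q"]) simp
qed

lemma recfn_computes: "recfn n f \<Longrightarrow> \<exists>p. computes p n f"
proof (induction rule: recfn.induct)
  case (zero_fn n)
  show ?case using yields_zero by (intro exI [of _ P_zero]) (simp add: computes_def)
next
  case succ_fn
  show ?case by (intro exI [of _ P_succ]) (auto simp: computes_def length_Suc_conv intro: yields_succ [simplified])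
next
  case (proj i n)
  then show ?case by (rule computes_nth)
next
  case (comp gs f n)
  obtain p where p: "computes p (length gs) f" using comp by blast
  obtain q where q: "\<forall>xs. length xs = n \<longrightarrow> yields q xs (map (\<lambda>g. g xs) gs)"
    using computes_map comp by blast
  show ?case using p q by (intro exI [of _ "P_comp p q"]) (auto simp: computes_def intro: yields_comp)
next
  case (prim_rec n f g)
  obtain p q where p: "computes p n f" and q: "computes q (Suc (Suc n)) g" using prim_rec by blast
  have "yields (P_rec p q) (k # xs) [rec_nat (f xs) (\<lambda>y r. g (y # r # xs)) k]" if "length xs = n" for k xs
  proof (induction k)
    case 0
    then show ?case using p that by (auto simp: computes_def intro: yields_rec_0)
  next
    case (Suc k)
    show ?case by (rule yields_rec_Suc [OF Suc]) (use q that in \<open>simp add: computes_def\<close>)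
  qed
  then show ?case by (intro exI [of _ "P_rec p q"]) (auto simp: computes_def length_Suc_conv)
next
  case (mu n f)
  obtain p where p: "computes p (Suc n) f" using mu by blast
  have "yields (P_mu p) xs [LEAST y. f (y # xs) = 0]" if xs: "length xs = n" for xs
  proof (rule yields_mu)
    have "\<exists>y. f (y # xs) = 0" using mu xs by blast
    then have "f ((LEAST y. f (y # xs) = 0) # xs) = 0" by (rule LeastI_ex)
    then show "yields p ((LEAST y. f (y # xs) = 0) # xs) [0]"
      using p xs unfolding computes_def by (metis length_Cons)
    show "\<forall>z<LEAST y. f (y # xs) = 0. \<exists>ys. ys \<noteq> [0] \<and> yields p (z # xs) ys"
    proof (intro allI impI)
      fix z assume "z < (LEAST y. f (y # xs) = 0)"
      then have "f (z # xs) \<noteq> 0" by (rule not_less_Least)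
      then show "\<exists>ys. ys \<noteq> [0] \<and> yields p (z # xs) ys"
        using p xs by (intro exI [of _ "[f (z # xs)]"]) (simp add: computes_def)
    qed
  qed
  then show ?case by (intro exI [of _ "P_mu p"]) (simp add: computes_def)
qed

subsection \<open>Enumerating the true statements about programs\<close>

type_synonym run = "nat \<times> nat list \<times> nat list"
type_synonym instr = "nat \<times> nat \<times> (nat \<times> nat) \<times> nat list \<times> nat list \<times> nat list"

text \<open>
  An inference \<open>(k, m, (p, q), xs, ys, zs)\<close> names the rule \<open>k\<close> and gives all of its parameters, so that neither
  its conclusion nor its premises have to be found by matching. In the rule \<open>8\<close> the intermediate
  result of the recursion is the head of \<open>zs\<close>. All the rule numbers from \<open>9\<close> on stand for
  minimisation, which makes every tuple an inference.
\<close>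

definition conclusion :: "instr \<Rightarrow> run" where
  "conclusion = (\<lambda>(k, m, (p, q), xs, ys, zs).
     if k = 0 then (P_zero, xs, [0])
     else if k = 1 then (P_succ, m # xs, [Suc m])
     else if k = 2 then (P_head, m # xs, [m])
     else if k = 3 then (P_tail, m # xs, xs)
     else if k = 4 then (P_empty, xs, [])
     else if k = 5 then (P_cons p q, xs, m # ys)
     else if k = 6 then (P_comp p q, xs, ys)
     else if k = 7 then (P_rec p q, 0 # xs, ys)
     else if k = 8 then (P_rec p q, Suc m # xs, ys)
     else (P_mu p, xs, [m]))"

definition justified :: "run list \<Rightarrow> instr \<Rightarrow> bool" where
  "justified D = (\<lambda>(k, m, (p, q), xs, ys, zs).
     if k < 5 then True
     else if k = 5 then (p, xs, [m]) \<in> set D \<and> (q, xs, ys) \<in> set D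
     else if k = 6 then (q, xs, zs) \<in> set D \<and> (p, zs, ys) \<in> set D
     else if k = 7 then (p, xs, ys) \<in> set D
     else if k = 8 then (P_rec p q, m # xs, [hd zs]) \<in> set D \<and> (q, m # hd zs # xs, ys) \<in> set D
     else (p, m # xs, [0]) \<in> set D \<and>
       (\<forall>z\<in>set [0..<m]. \<exists>r\<in>set D. fst r = p \<and> fst (snd r) = z # xs \<and> snd (snd r) \<noteq> [0]))"

text \<open>
  An unjustified inference is skipped, so that every list of inferences is a derivation.
\<close>

definition derive_step :: "run list \<Rightarrow> instr \<Rightarrow> run list" where
  "derive_step D i = (if justified D i then conclusion i # D else D)"

definition true_run :: "run \<Rightarrow> bool" where
  "true_run = (\<lambda>(p, xs, ys). yields p xs ys)"

lemma conclusion_sound: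
  assumes "\<forall>r\<in>set D. true_run r" "justified D i" shows "true_run (conclusion i)"
proof -
  obtain k m p q xs ys zs where i: "i = (k, m, (p, q), xs, ys, zs)" by (metis surj_pair)
  have yields: "yields a b c" if "(a, b, c) \<in> set D" for a b c
    using assms(1) that by (auto simp: true_run_def)
  show ?thesis
  proof (cases "k \<le> 8")
    case True
    then have "k \<in> {0, 1, 2, 3, 4, 5, 6, 7, 8}" by auto
    then show ?thesis using assms(2)
      by (auto simp: i conclusion_def justified_def true_run_def intro: yields.intros dest!: yields
          simp del: One_nat_def)
  next
    case False
    then have "(p, m # xs, [0]) \<in> set D"
      and pos: "\<forall>z\<in>set [0..<m]. \<exists>r\<in>set D. fst r = p \<and> fst (snd r) = z # xs \<and> snd (snd r) \<noteq> [0]"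
      using assms(2) by (simp_all add: i justified_def)
    then have "yields p (m # xs) [0]" by (intro yields)
    moreover have "\<exists>ys. ys \<noteq> [0] \<and> yields p (z # xs) ys" if z: "z < m" for z
    proof -
      have "\<exists>r\<in>set D. fst r = p \<and> fst (snd r) = z # xs \<and> snd (snd r) \<noteq> [0]"
        using pos z by simp
      then obtain r where "r \<in> set D" "fst r = p" "fst (snd r) = z # xs" "snd (snd r) \<noteq> [0]"
        by blast
      then show ?thesis using yields [of p "z # xs" "snd (snd r)"] by (metis prod.collapse)
    qed
    ultimately have "yields (P_mu p) xs [m]" by (intro yields_mu) auto
    then show ?thesis using False by (simp add: i conclusion_def true_run_def)
  qed
qed

lemma derive_sound:
  "\<forall>r\<in>set D. true_run r \<Longrightarrow> \<forall>r\<in>set (foldl derive_step D is). true_run r"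
proof (induction "is" arbitrary: D)
  case (Cons i "is")
  have "\<forall>r\<in>set (derive_step D i). true_run r"
    using Cons.prems conclusion_sound [of D i] by (simp add: derive_step_def)
  then show ?case using Cons.IH by simp
qed simp

definition derivable :: "run list \<Rightarrow> run list \<Rightarrow> bool" where
  "derivable D D' \<longleftrightarrow> set D \<subseteq> set D' \<and> (\<exists>is. foldl derive_step D is = D')"

lemma derivable_refl: "derivable D D"
  unfolding derivable_def by (auto intro: exI [of _ "[]"])

lemma derivable_trans: "derivable D D' \<Longrightarrow> derivable D' D'' \<Longrightarrow> derivable D D''"
  unfolding derivable_def by (metis foldl_append order_trans)

lemma derivable_step: "justified D i \<Longrightarrow> derivable D (conclusion i # D)"
  unfolding derivable_def by (auto intro: exI [of _ "[i]"] simp: derive_step_def)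

lemma derivable_by:
  assumes "derivable D D'" "justified D' i" "conclusion i = r"
  shows "\<exists>D'. derivable D D' \<and> r \<in> set D'"
  using derivable_trans [OF assms(1) derivable_step [OF assms(2)]] assms(3)
  by (intro exI [of _ "r # D'"]) simp

text \<open>
  The statement holds for every initial list \<open>D\<close>, so that the derivations of several premises can be run one after
  the other.
\<close>

lemma derive_complete: "yields p xs ys \<Longrightarrow> \<exists>D'. derivable D D' \<and> (p, xs, ys) \<in> set D'"
proof (induction p xs ys arbitrary: D rule: yields.induct)
  case (yields_zero xs)
  show ?case by (rule derivable_by [OF derivable_refl, of _ "(0, 0, (0, 0), xs, [], [])"])
    (simp_all add: justified_def conclusion_def)
next
  case (yields_succ x xs)
  show ?case by (rule derivable_by [OF derivable_refl, of _ "(1, x, (0, 0), xs, [], [])"])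
    (simp_all add: justified_def conclusion_def)
next
  case (yields_head x xs)
  show ?case by (rule derivable_by [OF derivable_refl, of _ "(2, x, (0, 0), xs, [], [])"])
    (simp_all add: justified_def conclusion_def)
next
  case (yields_tail x xs)
  show ?case by (rule derivable_by [OF derivable_refl, of _ "(3, x, (0, 0), xs, [], [])"])
    (simp_all add: justified_def conclusion_def)
next
  case (yields_empty xs)
  show ?case by (rule derivable_by [OF derivable_refl, of _ "(4, 0, (0, 0), xs, [], [])"])
    (simp_all add: justified_def conclusion_def)
next
  case (yields_cons p xs y q ys)
  obtain D1 where D1: "derivable D D1" "(p, xs, [y]) \<in> set D1" using yields_cons.IH(1) by blast
  obtain D2 where D2: "derivable D1 D2" "(q, xs, ys) \<in> set D2" using yields_cons.IH(2) by blast
  show ?case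
    by (rule derivable_by [OF derivable_trans [OF D1(1) D2(1)], of "(5, y, (p, q), xs, ys, [])"])
      (use D1 D2 in \<open>auto simp: justified_def conclusion_def derivable_def\<close>)
next
  case (yields_comp q xs zs p ys)
  obtain D1 where D1: "derivable D D1" "(q, xs, zs) \<in> set D1" using yields_comp.IH(1) by blast
  obtain D2 where D2: "derivable D1 D2" "(p, zs, ys) \<in> set D2" using yields_comp.IH(2) by blast
  show ?case
    by (rule derivable_by [OF derivable_trans [OF D1(1) D2(1)], of "(6, 0, (p, q), xs, ys, zs)"])
      (use D1 D2 in \<open>auto simp: justified_def conclusion_def derivable_def\<close>)
next
  case (yields_rec_0 p xs ys q)
  obtain D1 where D1: "derivable D D1" "(p, xs, ys) \<in> set D1" using yields_rec_0.IH by blast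
  show ?case
    by (rule derivable_by [OF D1(1), of "(7, 0, (p, q), xs, ys, [])"])
      (use D1 in \<open>auto simp: justified_def conclusion_def\<close>)
next
  case (yields_rec_Suc p q n xs r ys)
  obtain D1 where D1: "derivable D D1" "(P_rec p q, n # xs, [r]) \<in> set D1"
    using yields_rec_Suc.IH(1) by blast
  obtain D2 where D2: "derivable D1 D2" "(q, n # r # xs, ys) \<in> set D2"
    using yields_rec_Suc.IH(2) by blast
  show ?case
    by (rule derivable_by [OF derivable_trans [OF D1(1) D2(1)], of "(8, n, (p, q), xs, ys, [r])"])
      (use D1 D2 in \<open>auto simp: justified_def conclusion_def derivable_def\<close>)
next
  case (yields_mu p m xs)
  obtain D1 where D1: "derivable D D1" "(p, m # xs, [0]) \<in> set D1" using yields_mu.IH(1) by blast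
  have "\<exists>D2. derivable D1 D2 \<and> (\<forall>z<k. \<exists>ys. ys \<noteq> [0] \<and> (p, z # xs, ys) \<in> set D2)" if "k \<le> m" for k
    using that
  proof (induction k)
    case 0
    then show ?case using derivable_refl by auto
  next
    case (Suc k)
    then obtain D2 where D2: "derivable D1 D2" "\<forall>z<k. \<exists>ys. ys \<noteq> [0] \<and> (p, z # xs, ys) \<in> set D2"
      by auto
    obtain ys D3 where D3: "ys \<noteq> [0]" "derivable D2 D3" "(p, k # xs, ys) \<in> set D3"
      using yields_mu.IH(2) Suc.prems by (meson Suc_le_eq)
    have "set D2 \<subseteq> set D3" using D3(2) by (simp add: derivable_def)
    then have "\<forall>z<Suc k. \<exists>ys. ys \<noteq> [0] \<and> (p, z # xs, ys) \<in> set D3"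
      using D2(2) D3(1,3) unfolding less_Suc_eq by blast
    then show ?case using derivable_trans [OF D2(1) D3(2)] by blast
  qed
  from this [of m] obtain D2 where D2: "derivable D1 D2"
    "\<forall>z<m. \<exists>ys. ys \<noteq> [0] \<and> (p, z # xs, ys) \<in> set D2" by auto
  have "\<exists>r\<in>set D2. fst r = p \<and> fst (snd r) = z # xs \<and> snd (snd r) \<noteq> [0]" if "z < m" for z
    using D2(2) that by force
  moreover have "(p, m # xs, [0]) \<in> set D2" using D1(2) D2(1) by (auto simp: derivable_def)
  ultimately have "justified D2 (9, m, (p, 0), xs, [], [])" by (simp add: justified_def)
  then show ?case
    by (rule derivable_by [OF derivable_trans [OF D1(1) D2(1)]]) (simp add: conclusion_def)
qed

text \<open>
  The argument names the statement along with its derivation; if the derivation does not prove it, some fixed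
  true statement is returned. So the function is total and its range is exactly the set of true statements.
\<close>

definition enumerated_run :: "instr list \<times> run \<Rightarrow> run" where
  "enumerated_run s = (if snd s \<in> set (foldl derive_step [] (fst s)) then snd s else (P_zero, [], [0]))"

lemma range_enumerated_run: "range enumerated_run = {r. true_run r}"
proof (intro equalityI subsetI)
  fix r assume "r \<in> range enumerated_run"
  moreover have "true_run (P_zero, [], [0])" using yields_zero by (simp add: true_run_def)
  moreover have "\<forall>r\<in>set (foldl derive_step [] is). true_run r" for "is"
    using derive_sound [of "[]"] by simp
  ultimately show "r \<in> {r. true_run r}" by (auto simp: enumerated_run_def)
next
  fix r assume "r \<in> {r. true_run r}"
  then obtain D' where "derivable [] D'" "r \<in> set D'"
    using derive_complete [of "fst r" "fst (snd r)" "snd (snd r)" "[]"]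
    by (auto simp: true_run_def case_prod_beta)
  then obtain "is" where "r \<in> set (foldl derive_step [] is)" by (auto simp: derivable_def)
  then have "enumerated_run (is, r) = r" by (simp add: enumerated_run_def)
  then show "r \<in> range enumerated_run" by (metis rangeI)
qed

lemma computable_derive_step:
  "computable (\<lambda>x. derive_step (fst x) (snd x))"
  unfolding derive_step_def justified_def conclusion_def case_prod_beta
  by (intro computable_intros)

lemma computable_enumerated_run: "computable enumerated_run"
proof -
  have "computable (\<lambda>p. derive_step (fst p) (fst (snd p)))"
    by (rule computable_compose2 [OF computable_derive_step]) (intro computable_intros)+
  then have "computable (\<lambda>s. foldl (\<lambda>D i. derive_step D i) [] (fst s))"
    by (intro computable_foldl computable_intros)
  then show ?thesis
    unfolding enumerated_run_def by (intro computable_intros)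
qed

text \<open>
  For \<open>B = {x. \<exists>y. R x y}\<close> let \<open>p\<close> compute \<open>0\<close> from \<open>[y, x]\<close> if \<open>R x y\<close> and \<open>1\<close> otherwise. The search for a zero of \<open>p\<close>,
  followed by a constant program, yields \<open>[0]\<close> on \<open>[x]\<close> if and only if \<open>x \<in> B\<close>. Without that constant program
  the output would depend on the unknown witness and could not be named by the reduction.
\<close>

theorem universal_enumeration:
  obtains G :: "nat \<Rightarrow> nat" where "computable G"
    "\<And>B. Sigma01 B \<Longrightarrow> \<exists>h :: nat \<Rightarrow> nat. computable h \<and> (\<forall>x. x \<in> B \<longleftrightarrow> h x \<in> range G)"
proof
  let ?G = "\<lambda>n. enc (enumerated_run (dec n))"
  show "computable ?G"
    by (intro computable_intros computable_compose [OF computable_enumerated_run])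
  have range_G: "enc r \<in> range ?G \<longleftrightarrow> true_run r" for r
    using range_enumerated_run by (metis (mono_tags, lifting) dec_enc enc_eq_iff mem_Collect_eq rangeE rangeI)
  fix B assume "Sigma01 B"
  then obtain R f where f: "recfn 2 f" "\<And>xs. length xs = 2 \<Longrightarrow> f xs = of_bool (R (xs ! 0) (xs ! 1))"
    and B: "B = {x. \<exists>y. R x y}"
    unfolding Sigma01_def recursive_pred_def by (auto simp: of_bool_def)
  have "total_rec 2 (\<lambda>xs. f xs)" using f(1) by (auto simp: total_rec_def)
  then have "total_rec 2 (\<lambda>xs. of_bool (R (xs ! 0) (xs ! 1)))"
    by (rule total_rec_cong) (rule f(2))
  then have "total_rec 2 (\<lambda>xs. of_bool (R (xs ! 1) (xs ! 0)))"
    by (rule total_rec_comp2 [where h = "\<lambda>a b. of_bool (R a b)"]) (simp_all add: total_rec_nth)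
  then have "total_rec 2 (\<lambda>xs. Suc 0 - of_bool (R (xs ! 1) (xs ! 0)))"
    by (intro total_rec_diff total_rec_Suc total_rec_zero)
  then obtain g where g: "recfn 2 g" "\<And>xs. length xs = 2 \<Longrightarrow> g xs = Suc 0 - of_bool (R (xs ! 1) (xs ! 0))"
    by (auto simp: total_rec_def)
  obtain p where p: "computes p 2 g" using recfn_computes [OF g(1)] ..
  have p: "yields p [y, x] [of_bool (\<not> R x y)]" for x y
  proof -
    have "yields p [y, x] [g [y, x]]" using p by (simp add: computes_def)
    moreover have "g [y, x] = of_bool (\<not> R x y)" using g(2) [of "[y, x]"] by simp
    ultimately show ?thesis by simp
  qed
  have mu: "(\<exists>m. yields (P_mu p) [x] [m]) \<longleftrightarrow> (\<exists>y. R x y)" for x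
  proof
    assume "\<exists>m. yields (P_mu p) [x] [m]"
    then obtain m where "yields (P_mu p) [x] [m]" ..
    then have "yields p [m, x] [0]" by cases auto
    from yields_deterministic [OF this p] show "\<exists>y. R x y" by (cases "R x m") auto
  next
    assume ex: "\<exists>y. R x y"
    show "\<exists>m. yields (P_mu p) [x] [m]"
    proof (intro exI yields_mu)
      show "yields p [LEAST y. R x y, x] [0]" using p [of "LEAST y. R x y" x] LeastI_ex [OF ex] by simp
      show "\<forall>z<LEAST y. R x y. \<exists>ys. ys \<noteq> [0] \<and> yields p [z, x] ys"
      proof (intro allI impI exI conjI)
        fix z assume "z < (LEAST y. R x y)"
        then have "\<not> R x z" by (rule not_less_Least)
        then show "yields p [z, x] [1]" using p [of z x] by simp
      qed simp
    qed
  qed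
  have "x \<in> B \<longleftrightarrow> true_run (P_comp P_zero (P_mu p), [x], [0])" for x
  proof -
    have "yields (P_comp P_zero (P_mu p)) [x] [0] \<longleftrightarrow> (\<exists>m. yields (P_mu p) [x] [m])"
    proof
      assume "yields (P_comp P_zero (P_mu p)) [x] [0]"
      then obtain zs where zs: "yields (P_mu p) [x] zs" by cases auto
      then obtain m where "zs = [m]" by cases auto
      with zs show "\<exists>m. yields (P_mu p) [x] [m]" by blast
    qed (auto intro: yields_comp yields_zero)
    then show ?thesis by (simp add: true_run_def B mu)
  qed
  moreover have "computable (\<lambda>x. enc (P_comp P_zero (P_mu p), [x :: nat], [0 :: nat]))"
    by (intro computable_intros)
  ultimately show "\<exists>h :: nat \<Rightarrow> nat. computable h \<and> (\<forall>x. x \<in> B \<longleftrightarrow> h x \<in> range ?G)"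
    by (intro exI [of _ "\<lambda>x. enc (P_comp P_zero (P_mu p), [x], [0 :: nat])"]) (simp only: range_G simp_thms)
qed

section \<open>Sparse points and their subshifts\<close>

lemma window_Suc: "window x i (Suc n) = window x i n @ [x (i + int n)]"
  by (simp add: window_def)

lemma window_eq_iff: "window x i n = window y j n \<longleftrightarrow> (\<forall>k<n. x (i + int k) = y (j + int k))"
  by (auto simp: window_def)

text \<open>
  Nonzero letters are called marks.
\<close>

definition at_most_one_mark :: "nat set \<Rightarrow> nat list set" where
  "at_most_one_mark A = {w. filter (\<lambda>a. a \<noteq> 0) w = [] \<or> (\<exists>s\<in>A. filter (\<lambda>a. a \<noteq> 0) w = [s])}"

text \<open>
  Reads the condition on a window as a condition on coordinates; the second half says that at most one
  position carries a mark.
\<close>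

lemma window_in_one_mark_iff:
  assumes "0 \<notin> A"
  shows "window x i n \<in> at_most_one_mark A \<longleftrightarrow>
    (\<forall>p\<in>{i..<i + int n}. x p \<noteq> 0 \<longrightarrow> x p \<in> A) \<and>
    (\<forall>p\<in>{i..<i + int n}. \<forall>q\<in>{i..<i + int n}. x p \<noteq> 0 \<longrightarrow> x q \<noteq> 0 \<longrightarrow> p = q)"
proof (induction n)
  case 0
  then show ?case by (simp add: at_most_one_mark_def window_def)
next
  case (Suc n)
  have ins: "{i..<i + int (Suc n)} = insert (i + int n) {i..<i + int n}" by auto
  have notin: "i + int n \<notin> {i..<i + int n}" by simp
  have zeros: "filter (\<lambda>a. a \<noteq> 0) (window x i n) = [] \<longleftrightarrow> (\<forall>p\<in>{i..<i + int n}. x p = 0)"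
  proof -
    have "set (window x i n) = x ` {i..<i + int n}"
    proof (induction n)
      case (Suc n)
      have "{i..<i + int (Suc n)} = insert (i + int n) {i..<i + int n}" by auto
      then show ?case using Suc by (simp add: window_Suc)
    qed (simp add: window_def)
    then show ?thesis by (auto simp: filter_empty_conv)
  qed
  show ?case
  proof (cases "x (i + int n) = 0")
    case True
    then have "window x i (Suc n) \<in> at_most_one_mark A \<longleftrightarrow> window x i n \<in> at_most_one_mark A"
      by (simp add: at_most_one_mark_def window_Suc)
    then show ?thesis unfolding Suc ins using True by auto
  next
    case False
    then have "window x i (Suc n) \<in> at_most_one_mark A \<longleftrightarrow>
        x (i + int n) \<in> A \<and> filter (\<lambda>a. a \<noteq> 0) (window x i n) = []"
      by (auto simp: at_most_one_mark_def window_Suc append_eq_Cons_conv)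
    then show ?thesis unfolding zeros ins using False notin by auto
  qed
qed

definition single :: "nat \<Rightarrow> int \<Rightarrow> int \<Rightarrow> nat" where
  "single s c = (\<lambda>z. if z = c then s else 0)"

text \<open>
  For \<open>A \<subseteq> {1, 2}\<close> these are the nonempty proper subsystems of the theorem; the empty \<open>A\<close> gives the zero point.
\<close>

definition one_mark_shift :: "nat set \<Rightarrow> (int \<Rightarrow> nat) set" where
  "one_mark_shift A = {x. range x \<subseteq> {0, 1, 2} \<and> (\<forall>i n. window x i n \<in> at_most_one_mark A)}"

lemma mem_one_mark_shift_iff:
  assumes "A \<subseteq> {1, 2}"
  shows "x \<in> one_mark_shift A \<longleftrightarrow>
    (\<forall>p. x p \<noteq> 0 \<longrightarrow> x p \<in> A) \<and> (\<forall>p q. x p \<noteq> 0 \<longrightarrow> x q \<noteq> 0 \<longrightarrow> p = q)"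
proof -
  have 0: "0 \<notin> A" using assms by auto
  have cover: "\<exists>i n. p \<in> {i..<i + int n} \<and> q \<in> {i..<i + int n}" for p q :: int
    by (rule exI [of _ "min p q"], rule exI [of _ "nat (\<bar>p - q\<bar> + 1)"]) auto
  have "(\<forall>i n. window x i n \<in> at_most_one_mark A) \<longleftrightarrow>
      (\<forall>p. x p \<noteq> 0 \<longrightarrow> x p \<in> A) \<and> (\<forall>p q. x p \<noteq> 0 \<longrightarrow> x q \<noteq> 0 \<longrightarrow> p = q)"
    unfolding window_in_one_mark_iff [OF 0] using cover by meson
  moreover have "range x \<subseteq> {0, 1, 2}" if "\<forall>p. x p \<noteq> 0 \<longrightarrow> x p \<in> A"
  proof
    fix a assume "a \<in> range x"
    then obtain p where "a = x p" by blast
    then show "a \<in> {0, 1, 2}" using that [rule_format, of p] assms by (cases "x p = 0") auto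
  qed
  ultimately show ?thesis unfolding one_mark_shift_def mem_Collect_eq by (metis (no_types))
qed

lemma one_mark_shift_eq:
  assumes "A \<subseteq> {1, 2}"
  shows "one_mark_shift A = insert (\<lambda>_. 0) (\<Union>s\<in>A. range (single s))"
proof (intro equalityI subsetI)
  fix x assume "x \<in> one_mark_shift A"
  then have x: "\<And>p. x p \<noteq> 0 \<Longrightarrow> x p \<in> A" "\<And>p q. x p \<noteq> 0 \<Longrightarrow> x q \<noteq> 0 \<Longrightarrow> p = q"
    using mem_one_mark_shift_iff [OF assms] by blast+
  show "x \<in> insert (\<lambda>_. 0) (\<Union>s\<in>A. range (single s))"
  proof (cases "\<exists>p. x p \<noteq> 0")
    case True
    then obtain p where p: "x p \<noteq> 0" ..
    then have "x = single (x p) p" using x(2) by (fastforce simp: single_def)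
    then show ?thesis using x(1) [OF p] by blast
  qed auto
next
  fix x assume "x \<in> insert (\<lambda>_. 0) (\<Union>s\<in>A. range (single s))"
  then show "x \<in> one_mark_shift A"
    unfolding mem_one_mark_shift_iff [OF assms] by (auto simp: single_def split: if_splits)
qed

lemma subshift_one_mark_shift: "subshift {0, 1, 2} (one_mark_shift A)"
  unfolding one_mark_shift_def by (rule subshift_of_words)

lemma single_mem_one_mark_shift_iff:
  assumes "A \<subseteq> {1, 2}" "s \<in> {1, 2}" shows "single s c \<in> one_mark_shift A \<longleftrightarrow> s \<in> A"
  using assms unfolding mem_one_mark_shift_iff [OF assms(1)] by (auto simp: single_def)

lemma all_zero_eq_replicate: "\<forall>a\<in>set w. a = z \<Longrightarrow> w = replicate (length w) z"
  by (simp add: replicate_length_same)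

text \<open>
  The languages are given by a condition on the marks on the one hand and as sets of words \<open>0\<^sup>a s 0\<^sup>b\<close> on the other; this
  passes from the former to the latter.
\<close>

lemma one_mark_cases:
  assumes "w \<in> at_most_one_mark A"
  obtains a where "w = replicate a 0" | a s b where "s \<in> A" "w = replicate a 0 @ [s] @ replicate b 0"
proof -
  consider "filter (\<lambda>a. a \<noteq> 0) w = []" | s where "s \<in> A" "filter (\<lambda>a. a \<noteq> 0) w = [s]"
    using assms by (auto simp: at_most_one_mark_def)
  then show thesis
  proof cases
    case 1
    then have "w = replicate (length w) 0" by (intro all_zero_eq_replicate) (auto simp: filter_empty_conv)
    then show thesis by (rule that(1))
  next
    case 2
    then obtain us vs where w: "w = us @ s # vs" "\<forall>u\<in>set us. u = 0" "filter (\<lambda>a. a \<noteq> 0) vs = []"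
      by (auto simp: filter_eq_Cons_iff)
    then have "us = replicate (length us) 0" "vs = replicate (length vs) 0"
      by (auto intro!: all_zero_eq_replicate simp: filter_empty_conv)
    then show thesis using that(2) [OF 2(1), of "length us" "length vs"] w(1) by simp
  qed
qed

lemma at_most_one_mark_sublist: "sublist u w \<Longrightarrow> w \<in> at_most_one_mark A \<Longrightarrow> u \<in> at_most_one_mark A"
  by (auto simp: at_most_one_mark_def sublist_def append_eq_Cons_conv)

lemma factors_one_mark:
  assumes "A \<noteq> {}" "A \<subseteq> {1, 2}"
  shows "factors {replicate a 0 @ [s] @ replicate b 0 |a s b. s \<in> A} = at_most_one_mark A"
proof (intro equalityI subsetI)
  fix w assume "w \<in> factors {replicate a 0 @ [s] @ replicate b 0 |a s b. s \<in> A}"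
  then obtain a s b where "s \<in> A" "sublist w (replicate a 0 @ [s] @ replicate b 0)"
    by (auto simp: factors_def)
  moreover have "replicate a 0 @ [s] @ replicate b 0 \<in> at_most_one_mark A" if "s \<in> A"
    using that assms by (auto simp: at_most_one_mark_def)
  ultimately show "w \<in> at_most_one_mark A" using at_most_one_mark_sublist by blast
next
  fix w assume "w \<in> at_most_one_mark A"
  then show "w \<in> factors {replicate a 0 @ [s] @ replicate b 0 |a s b. s \<in> A}"
  proof (cases rule: one_mark_cases)
    case (1 a)
    obtain s where "s \<in> A" using assms by blast
    then have "replicate a 0 @ [s] @ replicate 0 0 \<in> {replicate a 0 @ [s] @ replicate b 0 |a s b. s \<in> A}"
      by blast
    moreover have "sublist w (replicate a 0 @ [s] @ replicate 0 0)" unfolding 1 by simp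
    ultimately show ?thesis unfolding factors_def by blast
  qed (auto simp: factors_def)
qed

lemma lang_inv_one_mark:
  assumes "A \<noteq> {}" "A \<subseteq> {1, 2}"
  shows "lang_inv {0, 1, 2} {replicate a 0 @ [s] @ replicate b 0 |a s b. s \<in> A} = one_mark_shift A"
    (is "lang_inv _ ?L = _")
proof -
  have "extendable ?L" unfolding extendable_def
  proof
    fix w assume "w \<in> ?L"
    then obtain a s b where w: "s \<in> A" "w = replicate a 0 @ [s] @ replicate b 0" by auto
    have "[0] @ w @ [0] = replicate (Suc a) 0 @ [s] @ replicate (Suc b) 0"
      by (simp add: w replicate_append_same)
    then have "[0] @ w @ [0] \<in> ?L" using w(1) by blast
    then show "\<exists>u v. u \<noteq> [] \<and> v \<noteq> [] \<and> u @ w @ v \<in> ?L"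
      by (intro exI [of _ "[0]"]) auto
  qed
  moreover have "?L \<subseteq> lists {0, 1, 2}" using assms(2) by auto
  ultimately show ?thesis
    by (simp add: lang_inv_eq factors_one_mark [OF assms, simplified] one_mark_shift_def)
qed

lemma lang_inv_zeros: "lang_inv {0, 1, 2} {replicate a 0 |a. True} = one_mark_shift {}"
    (is "lang_inv _ ?L = _")
proof -
  have "extendable ?L" unfolding extendable_def
  proof
    fix w :: "nat list" assume "w \<in> ?L"
    then obtain a where w: "w = replicate a 0" by auto
    have "[0] @ w @ [0] = replicate (Suc (Suc a)) 0" by (simp add: w replicate_append_same)
    then have "[0] @ w @ [0] \<in> ?L" by blast
    then show "\<exists>u v. u \<noteq> [] \<and> v \<noteq> [] \<and> u @ w @ v \<in> ?L" 
      by (intro exI [of _ "[0]"]) auto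
  qed
  moreover have "?L \<subseteq> lists {0, 1, 2}" by auto
  moreover have "factors ?L = at_most_one_mark {}"
  proof (intro equalityI subsetI)
    fix w assume "w \<in> factors ?L"
    then show "w \<in> at_most_one_mark {}"
      using at_most_one_mark_sublist [of w _ "{}"] by (auto simp: factors_def at_most_one_mark_def)
  next
    fix w :: "nat list" assume "w \<in> at_most_one_mark {}"
    then show "w \<in> factors ?L" by (cases rule: one_mark_cases) (auto simp: factors_def)
  qed
  ultimately show ?thesis by (simp add: lang_inv_eq one_mark_shift_def)
qed

subsection \<open>The point with marks at the squares\<close>

definition square_point :: "(nat \<Rightarrow> bool) \<Rightarrow> int \<Rightarrow> nat" where
  "square_point P z =
    (if \<exists>i. z = int (i * i) \<and> P i then 2 else if \<exists>i. z = int (i * i) then 1 else 0)"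

lemma square_point_square: "square_point P (int (i * i)) = (if P i then 2 else 1)"
proof -
  have "int (i * i) = int (j * j) \<longleftrightarrow> i = j" for j
    by (metis of_nat_eq_iff power2_eq_square power2_eq_iff_nonneg zero_le)
  then show ?thesis unfolding square_point_def by auto
qed

lemma square_point_nonzero_iff: "square_point P z \<noteq> 0 \<longleftrightarrow> (\<exists>i. z = int (i * i))"
  by (auto simp: square_point_def)

lemma range_square_point: "range (square_point P) \<subseteq> {0, 1, 2}"
  by (auto simp: square_point_def)

lemma square_gap: "i < j \<Longrightarrow> i * i + 2 * i + 1 \<le> j * (j :: nat)"
  using mult_le_mono [of "Suc i" j "Suc i" j] by simp

text \<open>
  The nearest squares to \<open>i\<^sup>2\<close> are at distance at least \<open>2 i - 1\<close>.
\<close>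

lemma square_point_isolated:
  assumes "z \<noteq> int (i * i)" "\<bar>z - int (i * i)\<bar> < int i" shows "square_point P z = 0"
proof (rule ccontr)
  assume "square_point P z \<noteq> 0"
  then obtain j where j: "z = int (j * j)" using square_point_nonzero_iff by blast
  then have "j < i \<or> i < j" using assms(1) by (metis linorder_neqE_nat)
  then show False
  proof
    assume "j < i"
    then obtain d where d: "i = Suc (j + d)" using less_imp_Suc_add by blast
    then have "int (j * j) + int i \<le> int (i * i)" by (simp add: algebra_simps)
    then show False using assms(2) unfolding j by linarith
  next
    assume "i < j"
    then have "int (i * i) + 2 * int i + 1 \<le> int (j * j)" using square_gap [of i j] by linarith
    then show False using assms(2) unfolding j by linarith
  qed
qed

text \<open>
  The predicate tells which squares carry a two. Both letters recur, so that every word with at most one mark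
  occurs.
\<close>

locale mark_pattern =
  fixes P :: "nat \<Rightarrow> bool"
  assumes twos: "\<exists>i\<ge>b. P i" and ones: "\<exists>i\<ge>b. \<not> P i"
begin

abbreviation x0 :: "int \<Rightarrow> nat" where "x0 \<equiv> square_point P"

text \<open>
  The words with at most one mark occur in \<open>x0\<close> arbitrarily far out, all others only near the origin. The two kinds
  are told apart because they are decided in different ways.
\<close>

definition words :: "nat list set" where
  "words = at_most_one_mark {1, 2} \<union> {w. occurs_in w x0}"

definition X :: "(int \<Rightarrow> nat) set" where
  "X = {x. range x \<subseteq> {0, 1, 2} \<and> (\<forall>i n. window x i n \<in> words)}"

lemma subshift_X: "subshift {0, 1, 2} X"
  unfolding X_def by (rule subshift_of_words)

lemma one_mark_occurs:
  assumes "w \<in> at_most_one_mark {1, 2}" shows "occurs_in w x0"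
proof -
  have occ: "occurs_in (replicate a 0 @ [s] @ replicate b 0) x0" if s: "s \<in> {1, 2}" for a s b
  proof -
    obtain i where i: "i \<ge> a + b + 1" "(if P i then 2 else 1) = s"
      using twos [of "a + b + 1"] ones [of "a + b + 1"] s by (metis insertE singletonD)
    have "window x0 (int (i * i) - int a) (a + Suc b) = replicate a 0 @ [s] @ replicate b 0"
    proof (rule nth_equalityI)
      fix k assume "k < length (window x0 (int (i * i) - int a) (a + Suc b))"
      then have k: "k < a + Suc b" by simp
      have "x0 (int (i * i) - int a + int k) = (if k = a then s else 0)"
        using square_point_square [of P i] i k
          square_point_isolated [of "int (i * i) - int a + int k" i P] by auto
      then show "window x0 (int (i * i) - int a) (a + Suc b) ! k =
          (replicate a 0 @ [s] @ replicate b 0) ! k"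
        using k by (auto simp: window_nth nth_append nth_Cons')
    qed simp
    then show ?thesis unfolding occurs_in_def
      by (intro exI [of _ "int (i * i) - int a"]) simp
  qed
  from assms show ?thesis
  proof (cases rule: one_mark_cases)
    case (1 a)
    have "sublist (replicate a 0) (replicate a 0 @ [1] @ replicate 0 0)" by simp
    then show ?thesis using occurs_in_sublist occ [of 1 a 0] unfolding 1 by blast
  next
    case (2 a s b)
    then show ?thesis using occ by simp
  qed
qed

lemma x0_in_X: "x0 \<in> X"
  using range_square_point by (auto simp: X_def words_def occurs_in_def)

lemma language_X: "language X = words"
proof (intro equalityI subsetI)
  fix w assume "w \<in> language X"
  then obtain x i where "x \<in> X" "window x i (length w) = w" by (auto simp: language_def occurs_in_def)
  then show "w \<in> words" unfolding X_def by (metis (mono_tags, lifting) mem_Collect_eq)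
next
  fix w assume "w \<in> words"
  then have "occurs_in w x0" using one_mark_occurs by (auto simp: words_def)
  then show "w \<in> language X" using x0_in_X by (auto simp: language_def)
qed

lemma words_occur: "w \<in> words \<Longrightarrow> occurs_in w x0"
  using one_mark_occurs by (auto simp: words_def)

lemma weakly_transitive_X: "weakly_transitive X"
  unfolding weakly_transitive_def language_X using x0_in_X words_occur by blast

text \<open>
  Two marks at the squares \<open>i\<^sup>2 < j\<^sup>2\<close> are at distance at least \<open>2 i + 1\<close>, so their distance bounds \<open>i\<close>.
\<close>

lemma mark_position_bound:
  assumes "x0 p \<noteq> 0" "x0 q \<noteq> 0" "p < q"
  shows "0 \<le> p" "p \<le> (q - p) * (q - p)"
proof -
  obtain i j where ij: "p = int (i * i)" "q = int (j * j)"
    using assms square_point_nonzero_iff by metis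
  then have "i * i < j * j" using assms(3) of_nat_less_iff by blast
  then have "i < j" by (meson leI mult_le_mono not_less)
  then have "int (i * i) + 2 * int i + 1 \<le> int (j * j)" using square_gap [of i j] by linarith
  then have "int i \<le> q - p" unfolding ij by linarith
  then have "int i * int i \<le> (q - p) * (q - p)" by (intro mult_mono) auto
  then show "0 \<le> p" "p \<le> (q - p) * (q - p)" using ij by auto
qed

lemma two_marks_of_not_one_mark:
  assumes "window x i n \<notin> at_most_one_mark {1, 2}" "range x \<subseteq> {0, 1, 2}"
  obtains p q where "i \<le> p" "p < q" "q < i + int n" "x p \<noteq> 0" "x q \<noteq> 0"
proof -
  have "x p \<in> {1, 2}" if "x p \<noteq> 0" for p
  proof -
    have "x p \<in> {0, 1, 2}" using assms(2) by blast
    then show ?thesis using that by blast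
  qed
  then obtain p q where "p \<in> {i..<i + int n}" "q \<in> {i..<i + int n}" "x p \<noteq> 0" "x q \<noteq> 0" "p \<noteq> q"
    using assms(1) window_in_one_mark_iff [of "{1, 2}" x i n] by auto
  then show thesis using that [of p q] that [of q p] by (cases "p < q") auto
qed

lemma zero_notin_marks: "0 \<notin> {1, 2 :: nat}"
  by simp

text \<open>
  A compactness argument. If the point \<open>x\<close> has marks at \<open>p < q\<close>, then each window that contains both occurs in \<open>x0\<close>,
  and the distance of \<open>p\<close> and \<open>q\<close> leaves only finitely many shifts by which it can do so. Some shift then serves for
  arbitrarily large windows, hence for all of \<open>x\<close>.
\<close>

lemma X_cases:
  assumes "x \<in> X"
  obtains t where "x = (\<lambda>z. x0 (z + t))" | "x \<in> one_mark_shift {1, 2}"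
proof (cases "x \<in> one_mark_shift {1, 2}")
  case False
  have rng: "range x \<subseteq> {0, 1, 2}" and win: "\<And>i n. window x i n \<in> words"
    using assms by (auto simp: X_def)
  obtain i n where "window x i n \<notin> at_most_one_mark {1, 2}" using False rng by (auto simp: one_mark_shift_def)
  from two_marks_of_not_one_mark [OF this rng]
  obtain p q where pq: "p < q" "x p \<noteq> 0" "x q \<noteq> 0" by metis
  \<comment> \<open>The window from \<open>p - N\<close> to \<open>q + N\<close> contains both marks.\<close>
  have "\<exists>t\<in>{- p..(q - p) * (q - p) - p}. \<forall>z\<in>{p - int N..q + int N}. x z = x0 (z + t)" for N
  proof -
    define n where "n = nat (q - p + 1) + 2 * N"
    have n: "p - int N + int n = q + int N + 1" using pq by (simp add: n_def)
    have "p \<in> {p - int N..<p - int N + int n}" "q \<in> {p - int N..<p - int N + int n}"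
      unfolding n using pq(1) by auto
    then have "window x (p - int N) n \<notin> at_most_one_mark {1, 2}"
      using pq unfolding window_in_one_mark_iff [OF zero_notin_marks] by (metis less_irrefl)
    then have "occurs_in (window x (p - int N) n) x0" using win words_occur by blast
    then obtain i where i: "window x0 i n = window x (p - int N) n" by (auto simp: occurs_in_def)
    define t where "t = i - (p - int N)"
    have eq: "x z = x0 (z + t)" if "z \<in> {p - int N..q + int N}" for z
    proof -
      have "nat (z - (p - int N)) < n" "int (nat (z - (p - int N))) = z - (p - int N)"
        using that n by auto
      then have "x0 (i + (z - (p - int N))) = x (p - int N + (z - (p - int N)))"
        using i [unfolded window_eq_iff] by metis
      then show ?thesis by (simp add: t_def algebra_simps)
    qed
    have "x0 (p + t) \<noteq> 0" "x0 (q + t) \<noteq> 0" "p + t < q + t" using eq [of p] eq [of q] pq by auto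
    from mark_position_bound [OF this] have "t \<in> {- p..(q - p) * (q - p) - p}" by auto
    then show ?thesis using eq by blast
  qed
  then obtain t where t: "\<And>N. t N \<in> {- p..(q - p) * (q - p) - p}"
    "\<And>N z. z \<in> {p - int N..q + int N} \<Longrightarrow> x z = x0 (z + t N)" by metis
  have "range t \<subseteq> {- p..(q - p) * (q - p) - p}" using t(1) by blast
  then have "finite (range t)" by (rule finite_subset) (rule finite_atLeastAtMost_int)
  then obtain N0 where inf: "infinite {N. t N = t N0}"
    using pigeonhole_infinite [of "UNIV :: nat set" t] by auto
  have "x z = x0 (z + t N0)" for z
  proof -
    obtain N where N: "N \<ge> nat (\<bar>z\<bar> + \<bar>p\<bar> + \<bar>q\<bar>)" "t N = t N0"
      using inf [unfolded infinite_nat_iff_unbounded_le] by blast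
    have "z \<in> {p - int N..q + int N}" using N(1) by auto
    from t(2) [OF this] show ?thesis by (simp add: N(2))
  qed
  then show thesis using that(1) by blast
qed (use that in blast)

lemma one_mark_shift_subset_X: 
  assumes "A \<subseteq> {1, 2}" shows "one_mark_shift A \<subseteq> X"
proof -
  have "at_most_one_mark A \<subseteq> at_most_one_mark {1, 2}" using assms unfolding at_most_one_mark_def by blast
  then have "at_most_one_mark A \<subseteq> words" by (auto simp: words_def)
  then show "one_mark_shift A \<subseteq> X" by (auto simp: one_mark_shift_def X_def)
qed

lemma X_eq: "X = range (\<lambda>t z. x0 (z + t)) \<union> one_mark_shift {1, 2}"
  using X_cases subshift_translate [OF subshift_X x0_in_X] one_mark_shift_subset_X [of "{1, 2}"]
  by (auto elim: X_cases)

lemma countable_X: "countable X"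
  unfolding X_eq by (auto simp: one_mark_shift_eq)

lemma x0_notin_one_mark_shift: "x0 \<notin> one_mark_shift {1, 2}"
  using square_point_nonzero_iff [of P 0] square_point_nonzero_iff [of P 1]
  unfolding mem_one_mark_shift_iff [OF subset_refl]
  by (metis mult_1 mult_zero_left of_nat_0 of_nat_1 zero_neq_one)

text \<open>
  A subsystem contains all the translates of its points, and if it is nonempty it contains the zero point as the
  limit of translates. So only the letters of its marks matter.
\<close>

lemma one_mark_shift_cases:
  assumes Y: "subshift {0, 1, 2} Y" "Y \<subseteq> one_mark_shift {1, 2}" "Y \<noteq> {}"
  shows "Y \<in> one_mark_shift ` Pow {1, 2}"
proof -
  define A where "A = {s \<in> {1, 2}. single s 0 \<in> Y}"
  have A: "A \<subseteq> {1, 2}" by (auto simp: A_def)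
  have move: "single s c \<in> Y \<Longrightarrow> single s d \<in> Y" for s c d
    using subshift_translate [OF Y(1), of "single s c" "c - d"] by (simp add: single_def algebra_simps)
  have "(\<lambda>_. 0) \<in> Y"
  proof -
    obtain y where y: "y \<in> Y" using Y(3) by blast
    have "window (\<lambda>_. 0) i n \<in> language Y" for i n
    proof -
      have "\<exists>j. window y j n = window (\<lambda>_. 0) i n"
      proof -
        consider "y = (\<lambda>_. 0)" | s c where "y = single s c"
          using y Y(2) one_mark_shift_eq [of "{1, 2}"] by auto
        then show ?thesis
        proof cases
          case 2
          then show ?thesis
            \<comment> \<open>To the right of its mark the point looks like zero.\<close>
            by (intro exI [of _ "c + 1"]) (simp add: window_eq_iff single_def)
        qed (auto simp: window_eq_iff)
      qed
      then show ?thesis using y by (auto simp: language_def occurs_in_def)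
    qed
    then have "(\<lambda>_. 0) \<in> {x. range x \<subseteq> {0, 1, 2} \<and> (\<forall>i n. window x i n \<in> language Y)}" by simp
    then show ?thesis by (simp only: subshift_eq_language [OF Y(1), symmetric])
  qed
  moreover have "single s c \<in> Y \<longleftrightarrow> s \<in> A" if "s \<in> {1, 2}" for s c
    using move [of s c 0] move [of s 0 c] that by (auto simp: A_def)
  moreover have "y = (\<lambda>_. 0) \<or> (\<exists>s\<in>{1, 2}. \<exists>c. y = single s c)" if "y \<in> Y" for y
    using Y(2) that unfolding one_mark_shift_eq [OF subset_refl] by blast
  ultimately have zero: "(\<lambda>_. 0) \<in> Y"
    and sgl: "\<And>s c. s \<in> {1, 2} \<Longrightarrow> single s c \<in> Y \<longleftrightarrow> s \<in> A"
    and cases: "\<And>y. y \<in> Y \<Longrightarrow> y = (\<lambda>_. 0) \<or> (\<exists>s\<in>{1, 2}. \<exists>c. y = single s c)" by blast+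
  have "Y = insert (\<lambda>_. 0) (\<Union>s\<in>A. range (single s))"
  proof (intro equalityI subsetI)
    fix y assume y: "y \<in> Y"
    from cases [OF y] show "y \<in> insert (\<lambda>_. 0) (\<Union>s\<in>A. range (single s))"
    proof
      assume "\<exists>s\<in>{1, 2}. \<exists>c. y = single s c"
      then obtain s c where "s \<in> {1, 2}" "y = single s c" by blast
      moreover from this have "s \<in> A" using y sgl by blast
      ultimately show ?thesis by blast
    qed simp
  next
    fix y assume "y \<in> insert (\<lambda>_. 0) (\<Union>s\<in>A. range (single s))"
    then show "y \<in> Y" using zero sgl A by auto
  qed
  then have "Y = one_mark_shift A" unfolding one_mark_shift_eq [OF A] by blast
  then show ?thesis using A by blast
qed

text \<open>
  A subsystem that contains a shift of \<open>x0\<close> has all the words of the language, hence is \<open>X\<close> itself.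
\<close>

lemma proper_subsystems_X:
  "{Y. subsystem {0, 1, 2} X Y \<and> Y \<noteq> X} = insert {} (one_mark_shift ` Pow {1, 2})"
proof (intro equalityI subsetI)
  fix Y assume "Y \<in> {Y. subsystem {0, 1, 2} X Y \<and> Y \<noteq> X}"
  then have Y: "subshift {0, 1, 2} Y" "Y \<subseteq> X" "Y \<noteq> X" by (auto simp: subsystem_def)
  have "(\<lambda>z. x0 (z + t)) \<notin> Y" for t
  proof
    assume "(\<lambda>z. x0 (z + t)) \<in> Y"
    from subshift_translate [OF Y(1) this, of "- t"] have "x0 \<in> Y" by simp
    then have "words \<subseteq> language Y" using words_occur by (auto simp: language_def)
    have "X \<subseteq> {x. range x \<subseteq> {0, 1, 2} \<and> (\<forall>i n. window x i n \<in> language Y)}"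
    proof (rule subsetI, intro CollectI conjI allI)
      fix x assume x: "x \<in> X"
      then show "range x \<subseteq> {0, 1, 2}" by (simp add: X_def)
      fix i n
      have "window x i n \<in> words" using x by (simp add: X_def)
      then show "window x i n \<in> language Y" using \<open>words \<subseteq> language Y\<close> by blast
    qed
    then have "X \<subseteq> Y" by (simp only: subshift_eq_language [OF Y(1), symmetric])
    then show False using Y by blast
  qed
  note no_x0 = this
  have "Y \<subseteq> one_mark_shift {1, 2}"
  proof
    fix y assume y: "y \<in> Y"
    then have "y \<in> X" using Y(2) by blast
    then show "y \<in> one_mark_shift {1, 2}" by (cases rule: X_cases) (use y no_x0 in blast)+
  qed
  then show "Y \<in> insert {} (one_mark_shift ` Pow {1, 2})"
    using one_mark_shift_cases [OF Y(1)] by blast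
next
  fix Y assume "Y \<in> insert {} (one_mark_shift ` Pow {1, 2})"
  then consider "Y = {}" | A where "A \<subseteq> {1, 2}" "Y = one_mark_shift A" by blast
  then show "Y \<in> {Y. subsystem {0, 1, 2} X Y \<and> Y \<noteq> X}"
  proof cases
    case 1
    then show ?thesis using x0_in_X by (auto simp: subsystem_def subshift_def)
  next
    case 2
    have "Y \<subseteq> one_mark_shift {1, 2}" using 2 unfolding 2(2) one_mark_shift_eq [OF 2(1)] one_mark_shift_eq [OF subset_refl] by blast
    then have "x0 \<notin> Y" using x0_notin_one_mark_shift by blast
    then show ?thesis using 2 subshift_one_mark_shift one_mark_shift_subset_X x0_in_X
      by (auto simp: subsystem_def)
  qed
qed

end

lemma inj_one_mark_shift: "inj_on one_mark_shift (Pow {1, 2})"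
proof (rule inj_onI)
  fix A B assume AB: "A \<in> Pow {1, 2}" "B \<in> Pow {1, 2 :: nat}" "one_mark_shift A = one_mark_shift B"
  have "s \<in> A \<longleftrightarrow> s \<in> B" if "s \<in> {1, 2}" for s
    using AB that single_mem_one_mark_shift_iff [of A s 0] single_mem_one_mark_shift_iff [of B s 0] by simp
  then show "A = B" using AB by blast
qed

section \<open>Decidability of the language\<close>

lemma list_encode_eq_enc: "list_encode ns = enc ns"
  by (simp add: enc_list_def map_idI)

lemma mem_set_upt_Suc: "i \<in> set [0..<Suc n] \<longleftrightarrow> i \<le> n"
  by (simp only: set_upt atLeastLessThan_iff less_Suc_eq_le le0 simp_thms)

lemma computable_square_point:
  assumes "decidable P" shows "computable (square_point P)"
proof -
  have sq: "(\<exists>i. z = int (i * i) \<and> Q i) \<longleftrightarrow> (\<exists>i\<in>set [0..<Suc (nat z)]. z = int (i * i) \<and> Q i)" for z Q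
  proof -
    have "i < Suc (nat (int (i * i)))" for i
      unfolding nat_int less_Suc_eq_le by (rule le_square)
    then show ?thesis by (metis atLeastLessThan_iff le0 set_upt)
  qed
  have "square_point P z = (if \<exists>i\<in>set [0..<Suc (nat z)]. z = int (i * i) \<and> P i then 2
      else if \<exists>i\<in>set [0..<Suc (nat z)]. z = int (i * i) \<and> True then 1 else 0)" for z
    unfolding square_point_def sq [symmetric] by simp
  then have "square_point P = (\<lambda>z. if \<exists>i\<in>set [0..<Suc (nat z)]. z = int (i * i) \<and> P i then 2
      else if \<exists>i\<in>set [0..<Suc (nat z)]. z = int (i * i) \<and> True then 1 else 0)" by blast
  then show ?thesis
    using assms by (simp only:) (intro computable_intros decidable_compose [OF assms])
qed

lemma computable_window:
  assumes x: "computable (\<lambda>p. x (fst p) (snd p))" and "computable u" "computable i" "computable n"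
  shows "computable (\<lambda>a. window (x (u a)) (i a) (n a))"
  unfolding window_def
  using assms(2-) by (intro computable_intros computable_compose2 [OF x] computable_compose [where f = snd])

text \<open>
  The points of \<open>X\<close> as a computable family: the first index selects \<open>x0\<close>, a single one, a single two or the zero
  point, and the second one is the shift.
\<close>

definition family :: "(nat \<Rightarrow> bool) \<Rightarrow> nat \<times> int \<Rightarrow> int \<Rightarrow> nat" where
  "family P u z = (if fst u = 0 then square_point P (z + snd u)
     else if fst u = 1 then (if z + snd u = 0 then 1 else 0)
     else if fst u = 2 then (if z + snd u = 0 then 2 else 0) else 0)"

lemma computable_family:
  assumes "decidable P" shows "computable (\<lambda>p. family P (fst p) (snd p))"
  unfolding family_def
  by (intro computable_intros computable_compose [OF computable_square_point [OF assms]])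

lemma (in mark_pattern) X_eq_family: "X = range (family P)"
proof (intro equalityI subsetI)
  fix x assume "x \<in> X"
  then show "x \<in> range (family P)"
  proof (cases rule: X_cases)
    case (1 t)
    then have "x = family P (0, t)" by (simp add: family_def fun_eq_iff)
    then show ?thesis by blast
  next
    case 2
    then consider "x = (\<lambda>_. 0)" | c where "x = single 1 c" | c where "x = single 2 c"
      unfolding one_mark_shift_eq [OF subset_refl] by blast
    then show ?thesis
    proof cases
      case 1
      then have "x = family P (3, 0)" by (simp add: family_def fun_eq_iff)
      then show ?thesis by blast
    next
      case (2 c)
      then have "x = family P (1, - c)" by (simp add: family_def fun_eq_iff single_def)
      then show ?thesis by blast
    next
      case (3 c)
      then have "x = family P (2, - c)" by (simp add: family_def fun_eq_iff single_def)
      then show ?thesis by blast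
    qed
  qed
next
  fix x assume "x \<in> range (family P)"
  then obtain m t where x: "x = family P (m, t)" by auto
  consider "m = 0" | "m = 1" | "m = 2" | "m > 2" by linarith
  then show "x \<in> X"
  proof cases
    case 1
    then have "x = (\<lambda>z. x0 (z + t))" by (simp add: x family_def fun_eq_iff)
    then show ?thesis using subshift_translate [OF subshift_X x0_in_X] by simp
  next
    case 2
    then have "x = single 1 (- t)" by (auto simp: x family_def fun_eq_iff single_def)
    then show ?thesis unfolding X_eq one_mark_shift_eq [OF subset_refl] by blast
  next
    case 3
    then have "x = single 2 (- t)" by (auto simp: x family_def fun_eq_iff single_def)
    then show ?thesis unfolding X_eq one_mark_shift_eq [OF subset_refl] by blast
  next
    case 4
    then have "x = (\<lambda>_. 0)" by (auto simp: x family_def fun_eq_iff)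
    then show ?thesis unfolding X_eq one_mark_shift_eq [OF subset_refl] by blast
  qed
qed

text \<open>
  An occurrence of a word of length \<open>n\<close> with two marks covers a mark at a square of a number that is at most \<open>n\<close>, so it
  begins between \<open>- n\<close> and \<open>n\<^sup>2\<close>.
\<close>

lemma (in mark_pattern) words_iff_bounded:
  "w \<in> words \<longleftrightarrow> w \<in> at_most_one_mark {1, 2} \<or>
    (\<exists>t\<in>set [0..<Suc (length w * length w + length w)]. window x0 (int t - int (length w)) (length w) = w)"
proof
  assume w: "w \<in> words"
  show "w \<in> at_most_one_mark {1, 2} \<or>
    (\<exists>t\<in>set [0..<Suc (length w * length w + length w)]. window x0 (int t - int (length w)) (length w) = w)"
  proof (cases "w \<in> at_most_one_mark {1, 2}")
    case False
    then obtain i where i: "window x0 i (length w) = w" using w by (auto simp: words_def occurs_in_def)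
    then obtain p q where pq: "i \<le> p" "p < q" "q < i + int (length w)" "x0 p \<noteq> 0" "x0 q \<noteq> 0"
      using two_marks_of_not_one_mark [OF _ range_square_point] False by metis
    have "(q - p) * (q - p) \<le> int (length w) * int (length w)"
      using pq(1-3) by (intro mult_mono) auto
    then have "0 \<le> i + int (length w)" "i \<le> int (length w) * int (length w)"
      using mark_position_bound [OF pq(4,5,2)] pq(1-3) by auto
    then have "nat (i + int (length w)) \<le> length w * length w + length w"
      "int (nat (i + int (length w))) - int (length w) = i"
      unfolding nat_le_iff by simp_all
    then show ?thesis using i mem_set_upt_Suc by metis
  qed simp
qed (auto simp: words_def occurs_in_def)

lemma decidable_one_mark: "decidable (\<lambda>w. w \<in> at_most_one_mark {1, 2})"
proof -
  have "w \<in> at_most_one_mark {1, 2} \<longleftrightarrow> filter (\<lambda>a. \<not> a = 0) w \<in> set [[], [1], [2]]" for w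
    by (auto simp: at_most_one_mark_def)
  then show ?thesis by (simp only:) (intro computable_intros)
qed

lemma (in mark_pattern) recursive_X:
  assumes "decidable P" shows "recursive_subshift X"
proof -
  have x0: "computable (\<lambda>p. x0 (snd p))"
    by (intro computable_compose [OF computable_square_point [OF assms]] computable_intros)
  have "decidable (\<lambda>w. w \<in> words)"
    unfolding words_iff_bounded
    by (intro decidable_one_mark computable_intros computable_window [where u = "\<lambda>_. 0 :: nat" and x = "\<lambda>_. x0", OF x0]
        computable_compose [where f = snd])
  moreover have "n \<in> list_encode ` words \<longleftrightarrow> dec n \<in> words" for n
    unfolding list_encode_eq_enc image_iff by (metis dec_enc enc_dec)
  ultimately have "decidable (\<lambda>n. n \<in> list_encode ` words)"
    using decidable_compose [of "\<lambda>w. w \<in> words" dec, OF _ computable_dec [OF computable_ident]] by simp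
  then show ?thesis
    unfolding recursive_subshift_def language_X by (rule recursive_set_of_decidable)
qed

section \<open>Semi-decidability of the counting problem\<close>

lemma funpow_lshift: "(lshift ^^ i) x = (\<lambda>z. x (z + int i))"
  by (induction i) (simp_all add: lshift_def algebra_simps)

definition in_cylinder :: "(nat \<Rightarrow> bool) \<Rightarrow> nat \<times> int \<Rightarrow> nat \<Rightarrow> clopen \<Rightarrow> bool" where
  "in_cylinder P u i c \<longleftrightarrow>
    (\<exists>w\<in>set (snd c). window (family P u) (fst c + int i) (length w) = w)"

lemma in_cylinder_iff: "in_cylinder P u i c \<longleftrightarrow> (lshift ^^ i) (family P u) \<in> cylinder c"
  by (simp add: in_cylinder_def cylinder_def funpow_lshift window_translate)

lemma decidable_in_cylinder:
  assumes P: "decidable P" and "computable u" "computable i" "computable c"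
  shows "decidable (\<lambda>a. in_cylinder P (u a) (i a) (c a))"
  unfolding in_cylinder_def using assms(2-)
  by (intro computable_intros computable_window [OF computable_family [OF P]] computable_compose [where f = snd])

text \<open>
  A solution consists of the index of a point, the number \<open>j\<close>, and a list that stands for the set \<open>A\<close> of its
  entries in \<open>[1, j - 1]\<close>.
\<close>

type_synonym counting_instance = "clopen \<times> clopen \<times> clopen \<times> clopen \<times> nat"
type_synonym counting_witness = "(nat \<times> int) \<times> nat \<times> nat list"

definition counting_witnessed :: "(nat \<Rightarrow> bool) \<Rightarrow> counting_instance \<Rightarrow> counting_witness \<Rightarrow> bool" where
  "counting_witnessed P = (\<lambda>(C, D, E, F, k) (u, j, as).
     length (filter (\<lambda>i. i \<in> set as) [1..<j]) = k \<and>
     in_cylinder P u 0 C \<and> in_cylinder P u j D \<and>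
     (\<forall>i\<in>set [1..<j]. if i \<in> set as then in_cylinder P u i F else in_cylinder P u i E))"

lemma (in mark_pattern) counting_holds_iff_witnessed:
  "counting_holds X C D E F k \<longleftrightarrow> (\<exists>v. counting_witnessed P (C, D, E, F, k) v)"
proof
  assume "counting_holds X C D E F k"
  then obtain u j A where A: "A \<subseteq> {1..<j}" "card A = k"
    "family P u \<in> cylinder C" "(lshift ^^ j) (family P u) \<in> cylinder D"
    "\<forall>i\<in>{1..<j} - A. (lshift ^^ i) (family P u) \<in> cylinder E"
    "\<forall>i\<in>A. (lshift ^^ i) (family P u) \<in> cylinder F"
    unfolding counting_holds_def X_eq_family by blast
  have "finite A" using A(1) finite_subset by blast
  then obtain as where as: "set as = A" using finite_list by blast
  have "set (filter (\<lambda>i. i \<in> A) [1..<j]) = A" using A(1) by auto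
  then have "length (filter (\<lambda>i. i \<in> A) [1..<j]) = k"
    using A(2) distinct_card [of "filter (\<lambda>i. i \<in> A) [1..<j]"] by simp
  then have "counting_witnessed P (C, D, E, F, k) (u, j, as)"
    using A(3-) by (auto simp: counting_witnessed_def as in_cylinder_iff)
  then show "\<exists>v. counting_witnessed P (C, D, E, F, k) v" ..
next
  assume "\<exists>v. counting_witnessed P (C, D, E, F, k) v"
  then obtain u j as where v: "counting_witnessed P (C, D, E, F, k) (u, j, as)" by (metis surj_pair)
  define A where "A = {i \<in> {1..<j}. i \<in> set as}"
  have "A = set (filter (\<lambda>i. i \<in> set as) [1..<j])" by (auto simp: A_def)
  then have "card A = k" using v distinct_card [of "filter (\<lambda>i. i \<in> set as) [1..<j]"]
    by (simp add: counting_witnessed_def)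
  moreover have "A \<subseteq> {1..<j}" by (auto simp: A_def)
  moreover have "family P u \<in> cylinder C" "(lshift ^^ j) (family P u) \<in> cylinder D"
    using v in_cylinder_iff [of P u 0 C] by (simp_all add: counting_witnessed_def in_cylinder_iff)
  moreover have cyl: "if i \<in> set as then (lshift ^^ i) (family P u) \<in> cylinder F
      else (lshift ^^ i) (family P u) \<in> cylinder E" if "i \<in> {1..<j}" for i
    using v that unfolding counting_witnessed_def in_cylinder_iff by simp
  have "(lshift ^^ i) (family P u) \<in> cylinder E" if "i \<in> {1..<j} - A" for i
    using cyl [of i] that by (simp add: A_def)
  moreover have "(lshift ^^ i) (family P u) \<in> cylinder F" if "i \<in> A" for i
    using cyl [of i] that by (simp add: A_def)
  ultimately show "counting_holds X C D E F k"
    unfolding counting_holds_def X_eq_family by blast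
qed

lemma decidable_counting_witnessed:
  assumes P: "decidable P" and "computable I" "computable v"
  shows "decidable (\<lambda>a. counting_witnessed P (I a) (v a))"
proof -
  have "decidable (\<lambda>p. counting_witnessed P (fst p) (snd p))"
    unfolding counting_witnessed_def case_prod_beta
    by (intro computable_intros decidable_in_cylinder [OF P])
  from decidable_compose [OF this, of "\<lambda>a. (I a, v a)"] assms(2,3) show ?thesis
    by (simp add: computable_intros)
qed

text \<open>
  The common word length of a clopen set joins the witnesses of the search, so validity need not be
  decided.
\<close>

definition words_over :: "nat list \<Rightarrow> nat \<Rightarrow> clopen \<Rightarrow> bool" where
  "words_over S n c \<longleftrightarrow> (\<forall>w\<in>set (snd c). length w = n \<and> (\<forall>a\<in>set w. a \<in> set S))"

lemma valid_clopen_iff: "valid_clopen (set S) c \<longleftrightarrow> (\<exists>n. words_over S n c)"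
  by (auto simp: valid_clopen_def words_over_def subset_iff)

lemma decidable_words_over:
  assumes "computable n" "computable c" shows "decidable (\<lambda>a. words_over S (n a) (c a))"
  unfolding words_over_def using assms
  by (intro computable_intros computable_compose [where f = snd])

lemma clopen_encode_eq_enc: "clopen_encode c = enc c"
proof -
  have "map list_encode (snd c) = map enc (snd c)" by (simp add: list_encode_eq_enc)
  then show ?thesis by (simp only: clopen_encode_def enc_prod_def enc_int_def enc_list_def)
qed

definition instance_code :: "counting_instance \<Rightarrow> nat" where
  "instance_code = (\<lambda>(C, D, E, F, k). enc [enc C, enc D, enc E, enc F, k])"

definition valid_instance :: "nat list \<Rightarrow> nat \<times> nat \<times> nat \<times> nat \<Rightarrow> counting_instance \<Rightarrow> bool" where
  "valid_instance S = (\<lambda>(a, b, c, d) (C, D, E, F, k).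
     words_over S a C \<and> words_over S b D \<and> words_over S c E \<and> words_over S d F)"

lemma (in mark_pattern) Sigma01_counting_problem:
  assumes P: "decidable P" shows "Sigma01 (counting_problem {0, 1, 2} X)"
proof -
  let ?Q = "\<lambda>n w. n = instance_code (fst w) \<and> valid_instance [0, 1, 2] (fst (snd w)) (fst w) \<and>
    counting_witnessed P (fst w) (snd (snd w))"
  have valid: "valid_clopen {0, 1, 2} c \<longleftrightarrow> (\<exists>n. words_over [0, 1, 2] n c)" for c
    using valid_clopen_iff [of "[0, 1, 2]" c] by simp
  have eq: "counting_problem {0, 1, 2} X = {n. \<exists>w. ?Q n w}"
  proof (intro equalityI subsetI)
    fix n assume "n \<in> counting_problem {0, 1, 2} X"
    then obtain C D E F k a b c d v where
      "n = list_encode [clopen_encode C, clopen_encode D, clopen_encode E, clopen_encode F, k]"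
      "words_over [0, 1, 2] a C" "words_over [0, 1, 2] b D" "words_over [0, 1, 2] c E"
      "words_over [0, 1, 2] d F" "counting_witnessed P (C, D, E, F, k) v"
      unfolding counting_problem_def valid counting_holds_iff_witnessed by blast
    then have "?Q n ((C, D, E, F, k), (a, b, c, d), v)"
      by (simp add: instance_code_def valid_instance_def clopen_encode_eq_enc list_encode_eq_enc)
    then show "n \<in> {n. \<exists>w. ?Q n w}" by blast
  next
    fix n assume "n \<in> {n. \<exists>w. ?Q n w}"
    then obtain C D E F k a b c d v where "?Q n ((C, D, E, F, k), (a, b, c, d), v)" by auto
    then have "n = enc [enc C, enc D, enc E, enc F, k]" "words_over [0, 1, 2] a C"
      "words_over [0, 1, 2] b D" "words_over [0, 1, 2] c E" "words_over [0, 1, 2] d F"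
      "counting_witnessed P (C, D, E, F, k) v"
      by (simp_all add: instance_code_def valid_instance_def)
    then show "n \<in> counting_problem {0, 1, 2} X"
      unfolding counting_problem_def valid counting_holds_iff_witnessed
        clopen_encode_eq_enc list_encode_eq_enc
      by blast
  qed
  have "decidable (\<lambda>p. ?Q (fst p) (snd p))"
    unfolding instance_code_def valid_instance_def case_prod_beta
    by (intro computable_intros decidable_words_over decidable_counting_witnessed [OF P])
  then have "Sigma01 {n. \<exists>w. ?Q n w}" by (rule Sigma01_of_decidable)
  then show ?thesis by (simp only: eq)
qed

section \<open>Counting ones between twos\<close>

abbreviation letter :: "nat \<Rightarrow> clopen" where
  "letter s \<equiv> (0, [[s]])"

lemma mem_cylinder_letter: "x \<in> cylinder (letter s) \<longleftrightarrow> x 0 = s"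
  by (simp add: cylinder_def window_def)

context mark_pattern begin

text \<open>
  For \<open>k > 0\<close> a solution has twos at the positions \<open>0\<close> and \<open>j > 0\<close>, which rules out the points with at most one mark.
  In a shift of \<open>x0\<close> the set \<open>A\<close> is forced to consist of all the marks in between, so these are \<open>k\<close> ones.
  For \<open>k = 0\<close> the choice \<open>j = 0\<close> would always be a solution.
\<close>

lemma counting_letters_iff:
  assumes "0 < k"
  shows "counting_holds X (letter 2) (letter 2) (letter 0) (letter 1) k \<longleftrightarrow>
    (\<exists>i. P i \<and> P (i + Suc k) \<and> (\<forall>l. i < l \<longrightarrow> l < i + Suc k \<longrightarrow> \<not> P l))"
    (is "?count \<longleftrightarrow> ?block")
proof
  assume ?count
  then obtain x j A where A: "x \<in> X" "A \<subseteq> {1..<j}" "card A = k" "x 0 = 2" "x (int j) = 2"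
    "\<forall>i\<in>{1..<j} - A. x (int i) = 0" "\<forall>i\<in>A. x (int i) = 1"
    unfolding counting_holds_def mem_cylinder_letter funpow_lshift by auto
  have "A \<noteq> {}" using assms A(3) by auto
  then have "j > 0" using A(2) by force
  then have "x \<notin> one_mark_shift {1, 2}"
    unfolding mem_one_mark_shift_iff [OF subset_refl] using A(4,5)
    by (metis of_nat_0_less_iff less_irrefl zero_neq_numeral)
  then obtain t where x: "x = (\<lambda>z. x0 (z + t))" using X_cases [OF A(1)] by metis
  obtain a where a: "t = int (a * a)" using A(4) square_point_nonzero_iff [of P t] by (auto simp: x)
  obtain b where b: "int j + t = int (b * b)"
    using A(5) square_point_nonzero_iff [of P "int j + t"] by (auto simp: x)
  have "x0 (int (a * a)) = 2" "x0 (int (b * b)) = 2"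
    using A(4,5) unfolding x b by (simp_all add: a del: of_nat_mult)
  then have P: "P a" "P b" unfolding square_point_square by (simp_all split: if_splits)
  have jb: "j + a * a = b * b" using b unfolding a by linarith
  have "a < b" using jb \<open>j > 0\<close> by (metis add_lessD1 less_add_same_cancel2 mult_le_mono not_less)
  \<comment> \<open>The position of the \<open>l\<close>-th mark in \<open>x\<close>, as the two at the origin is mark number \<open>a\<close>.\<close>
  define pos where "pos = (\<lambda>l. l * l - a * a)"
  have pos: "pos l + a * a = l * l" if "a < l" for l
    using square_gap [OF that] by (simp add: pos_def)
  have A_eq: "A = pos ` {a<..<b}"
  proof (intro equalityI subsetI)
    fix i assume i: "i \<in> A"
    then have "x0 (int i + t) \<noteq> 0" using A(7) by (simp add: x)
    then obtain l where "int i + t = int (l * l)" using square_point_nonzero_iff by blast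
    then have l: "i + a * a = l * l" unfolding a by linarith
    have "1 \<le> i" "i < j" using i A(2) by auto
    then have "a * a < l * l" "l * l < b * b" using l jb by linarith+
    then have "a < l" "l < b" by (meson mult_le_mono not_less)+
    moreover from this have "i = pos l" using l by (simp add: pos_def)
    ultimately show "i \<in> pos ` {a<..<b}" by simp
  next
    fix i assume "i \<in> pos ` {a<..<b}"
    then obtain l where l: "a < l" "l < b" "i = pos l" by auto
    have "int i + t = int (l * l)" using pos [OF l(1)] l(3) unfolding a by linarith
    then have "x (int i) \<noteq> 0" using square_point_nonzero_iff by (auto simp: x)
    moreover have "1 \<le> i" "i < j"
      using square_gap [OF l(1)] square_gap [OF l(2)] pos [OF l(1)] jb l(3) by linarith+
    ultimately show "i \<in> A" using bspec [OF A(6), of i] by auto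
  qed
  have "inj_on pos {a<..<b}"
  proof (rule inj_onI)
    fix l m assume lm: "l \<in> {a<..<b}" "m \<in> {a<..<b}" "pos l = pos m"
    then have "l * l = m * m" using pos [of l] pos [of m] by simp
    then show "l = m" using square_gap [of l m] square_gap [of m l]
      by (cases l m rule: linorder_cases) auto
  qed
  then have "k = b - Suc a" using A(3) by (simp add: A_eq card_image)
  then have "b = a + Suc k" using \<open>a < b\<close> assms by simp
  moreover have "\<not> P l" if "a < l" "l < b" for l
  proof -
    have "pos l \<in> A" using that by (simp add: A_eq)
    then have "x0 (int (pos l) + t) = 1" using A(7) by (simp add: x)
    moreover have "int (pos l) + t = int (l * l)" using pos [OF that(1)] unfolding a by linarith
    ultimately show ?thesis using square_point_square [of P l] by (auto split: if_splits)
  qed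
  ultimately show ?block using P by blast
next
  assume ?block
  then obtain a where a: "P a" "P (a + Suc k)" "\<And>l. a < l \<Longrightarrow> l < a + Suc k \<Longrightarrow> \<not> P l" by blast
  define b where "b = a + Suc k"
  define x where "x = (\<lambda>z. x0 (z + int (a * a)))"
  define pos where "pos = (\<lambda>l. l * l - a * a)"
  have pos: "pos l + a * a = l * l" if "a \<le> l" for l
    using mult_le_mono [OF that that] by (simp add: pos_def)
  have x_pos: "x (int (pos l)) = (if P l then 2 else 1)" if "a \<le> l" for l
  proof -
    have "int (pos l) + int (a * a) = int (l * l)" using pos [OF that] by linarith
    then show ?thesis using square_point_square [of P l] by (simp add: x_def)
  qed
  have mono: "pos l < pos m" if "a \<le> l" "l < m" for l m
    using square_gap [OF that(2)] pos [of l] pos [of m] that by linarith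
  have pos_a: "pos a = 0" by (simp add: pos_def)
  show ?count
    unfolding counting_holds_def mem_cylinder_letter funpow_lshift
  proof (intro bexI exI conjI)
    show "x \<in> X" unfolding x_def by (rule subshift_translate [OF subshift_X x0_in_X])
    show sub: "pos ` {a<..<b} \<subseteq> {1..<pos b}"
    proof
      fix i assume "i \<in> pos ` {a<..<b}"
      then obtain l where "a < l" "l < b" "i = pos l" by auto
      then show "i \<in> {1..<pos b}" using mono [of a l] mono [of l b] pos_a by simp
    qed
    have "inj_on pos {a<..<b}"
    proof (rule inj_onI)
      fix l m assume "l \<in> {a<..<b}" "m \<in> {a<..<b}" "pos l = pos m"
      then show "l = m" using mono [of l m] mono [of m l] by (cases l m rule: linorder_cases) auto
    qed
    then show "card (pos ` {a<..<b}) = k" by (simp add: card_image b_def)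
    show "x 0 = 2" using x_pos [of a] a(1) pos_a by simp
    show "x (0 + int (pos b)) = 2" using x_pos [of b] a(2) by (simp add: b_def)
    show "\<forall>i\<in>pos ` {a<..<b}. x (0 + int i) = 1" using x_pos a(3) by (auto simp: b_def)
    show "\<forall>i\<in>{1..<pos b} - pos ` {a<..<b}. x (0 + int i) = 0"
    proof (intro ballI, rule ccontr)
      fix i assume i: "i \<in> {1..<pos b} - pos ` {a<..<b}" "x (0 + int i) \<noteq> 0"
      then obtain l where "int i + int (a * a) = int (l * l)"
        using square_point_nonzero_iff by (auto simp: x_def)
      then have l: "i + a * a = l * l" by linarith
      have "1 \<le> i" "i < pos b" using i by auto
      then have "a * a < l * l" "l * l < b * b" using l pos [of b] by (auto simp: b_def)
      then have "a < l" "l < b" by (meson mult_le_mono not_less)+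
      moreover from this have "i = pos l" using l by (simp add: pos_def)
      ultimately show False using i(1) by auto
    qed
  qed
qed

end

text \<open>
  The index of the \<open>n\<close>-th two among the marks; between it and the next one there are \<open>Suc (g n)\<close> ones. The extra one
  makes all the numbers of ones positive and lets ones occur infinitely often even if \<open>g\<close> is zero.
\<close>

primrec two_index :: "(nat \<Rightarrow> nat) \<Rightarrow> nat \<Rightarrow> nat" where
  "two_index g 0 = 0"
| "two_index g (Suc n) = two_index g n + g n + 2"

lemma strict_mono_two_index: "strict_mono (two_index g)"
  by (rule strict_monoI_Suc) simp

lemma le_two_index: "n \<le> two_index g n"
  using strict_mono_imp_increasing [OF strict_mono_two_index] .

lemma between_two_index:
  assumes "two_index g n < l" "l < two_index g (Suc n)" shows "l \<notin> range (two_index g)"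
proof
  assume "l \<in> range (two_index g)"
  then obtain m where "l = two_index g m" ..
  then have "n < m" "m < Suc n"
    using assms strict_mono_less [OF strict_mono_two_index, of g] by blast+
  then show False by simp
qed

lemma mark_pattern_two_index: "mark_pattern (\<lambda>i. i \<in> range (two_index g))"
proof
  fix b
  show "\<exists>i\<ge>b. i \<in> range (two_index g)" using le_two_index by blast
  have "two_index g b + 1 \<notin> range (two_index g)" by (rule between_two_index [of g b]) simp_all
  moreover have "b \<le> two_index g b + 1" using le_two_index [of b g] by simp
  ultimately show "\<exists>i\<ge>b. i \<notin> range (two_index g)" by blast
qed

lemma two_index_blocks:
  assumes "0 < k"
  shows "(\<exists>i. i \<in> range (two_index g) \<and> i + Suc k \<in> range (two_index g) \<and>
      (\<forall>l. i < l \<longrightarrow> l < i + Suc k \<longrightarrow> l \<notin> range (two_index g))) \<longleftrightarrow> k \<in> Suc ` range g"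
    (is "?block \<longleftrightarrow> _")
proof
  assume ?block
  then obtain n m where nm: "two_index g n + Suc k = two_index g m"
    "\<And>l. two_index g n < l \<Longrightarrow> l < two_index g m \<Longrightarrow> l \<notin> range (two_index g)"
    by auto
  have "two_index g n < two_index g (Suc n)" by simp
  then have "\<not> two_index g (Suc n) < two_index g m" using nm(2) by blast
  moreover have "n < m" using nm(1) strict_mono_less [OF strict_mono_two_index, of g n m] by simp
  ultimately have "m = Suc n" using strict_mono_less [OF strict_mono_two_index, of g "Suc n" m] by simp
  then have "k = Suc (g n)" using nm(1) by simp
  then show "k \<in> Suc ` range g" by simp
next
  assume "k \<in> Suc ` range g"
  then obtain n where "k = Suc (g n)" by auto
  then have "two_index g n + Suc k = two_index g (Suc n)" by simp
  then show ?block using between_two_index [of g n] by (metis rangeI)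
qed

lemma decidable_two_index:
  assumes "computable g" shows "decidable (\<lambda>i. i \<in> range (two_index g))"
proof -
  have "two_index g n = rec_nat 0 (\<lambda>m r. r + g m + 2) n" for n by (induction n) auto
  moreover have "computable (\<lambda>n. rec_nat 0 (\<lambda>m r. r + g m + 2) n)"
    by (intro computable_intros computable_compose [OF assms])
  ultimately have index: "computable (two_index g)" by presburger
  have "i \<in> range (two_index g) \<longleftrightarrow> (\<exists>n\<in>set [0..<Suc i]. two_index g n = i)" for i
  proof
    assume "i \<in> range (two_index g)"
    then obtain n where n: "i = two_index g n" ..
    then have "n \<in> set [0..<Suc i]" using le_two_index [of n g] by (simp only: mem_set_upt_Suc)
    then show "\<exists>n\<in>set [0..<Suc i]. two_index g n = i" using n by blast
  qed blast
  moreover have "decidable (\<lambda>i. \<exists>n\<in>set [0..<Suc i]. two_index g n = i)"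
    by (intro computable_intros computable_compose [OF index])
  ultimately show ?thesis by presburger
qed

theorem theorem5:
  "\<exists>(S :: nat set) (X :: (int \<Rightarrow> nat) set).
     finite S \<and> {0, 1, 2} \<subseteq> S \<and> subshift S X \<and>
     recursive_subshift X \<and> countable X \<and> weakly_transitive X \<and> quasiminimal S X \<and>
     Sigma01_complete (counting_problem S X) \<and>
     {Y. subsystem S X Y \<and> Y \<noteq> X \<and> Y \<noteq> {}} =
       {lang_inv S {replicate a 0 @ [s] @ replicate b 0 |a s b. s \<in> {1, 2}},
        lang_inv S {replicate a 0 @ [2] @ replicate b 0 |a b. True},
        lang_inv S {replicate a 0 @ [1] @ replicate b 0 |a b. True},
        lang_inv S {replicate a 0 |a. True}} \<and>
     card {Y. subsystem S X Y \<and> Y \<noteq> X \<and> Y \<noteq> {}} = 4"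
proof -
  obtain G :: "nat \<Rightarrow> nat" where G: "computable G"
    "\<And>B. Sigma01 B \<Longrightarrow> \<exists>h :: nat \<Rightarrow> nat. computable h \<and> (\<forall>x. x \<in> B \<longleftrightarrow> h x \<in> range G)"
    by (rule universal_enumeration) blast
  define P where "P = (\<lambda>i. i \<in> range (two_index G))"
  interpret mark_pattern P unfolding P_def by (rule mark_pattern_two_index)
  have P: "decidable P" unfolding P_def by (rule decidable_two_index [OF G(1)])
  let ?S = "{0, 1, 2} :: nat set"
  have complete: "Sigma01_complete (counting_problem ?S X)"
    unfolding Sigma01_complete_def
  proof (intro conjI allI impI)
    show "Sigma01 (counting_problem ?S X)" by (rule Sigma01_counting_problem [OF P])
    fix B assume "Sigma01 B"
    then obtain h :: "nat \<Rightarrow> nat" where h: "computable h" "\<And>x. x \<in> B \<longleftrightarrow> h x \<in> range G"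
      using G(2) by blast
    define f where "f = (\<lambda>x. list_encode [clopen_encode (letter 2), clopen_encode (letter 2),
      clopen_encode (letter 0), clopen_encode (letter 1), Suc (h x)])"
    have "computable f"
      unfolding f_def list_encode_eq_enc by (intro computable_intros h(1))
    then obtain r where r: "recfn 1 r" "\<And>x. r [x] = f x" using recfn_of_computable by blast
    have "x \<in> B \<longleftrightarrow> f x \<in> counting_problem ?S X" for x
    proof -
      have "f x \<in> counting_problem ?S X \<longleftrightarrow>
          counting_holds X (letter 2) (letter 2) (letter 0) (letter 1) (Suc (h x))"
        unfolding counting_problem_def f_def
        by (auto simp: list_encode_eq clopen_encode_eq_enc valid_clopen_def)
      also have "\<dots> \<longleftrightarrow> Suc (h x) \<in> Suc ` range G"
        unfolding counting_letters_iff [OF zero_less_Suc] unfolding P_def by (rule two_index_blocks) simp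
      also have "\<dots> \<longleftrightarrow> x \<in> B" using h(2) by auto
      finally show ?thesis by blast
    qed
    then show "many_one_reducible B (counting_problem ?S X)"
      unfolding many_one_reducible_def using r by metis
  qed
  have "{Y. subsystem ?S X Y \<and> Y \<noteq> X \<and> Y \<noteq> {}} = {Y. subsystem ?S X Y \<and> Y \<noteq> X} - {{}}" by blast
  also have "\<dots> = one_mark_shift ` Pow {1, 2}"
  proof -
    have "one_mark_shift A \<noteq> {}" if "A \<in> Pow {1, 2}" for A using that by (simp add: one_mark_shift_eq)
    then show ?thesis unfolding proper_subsystems_X by blast
  qed
  finally have subsystems: "{Y. subsystem ?S X Y \<and> Y \<noteq> X \<and> Y \<noteq> {}} = one_mark_shift ` Pow {1, 2}" .
  have "card (Pow {1, 2 :: nat}) = 4" by (simp add: card_Pow)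
  then have card4: "card {Y. subsystem ?S X Y \<and> Y \<noteq> X \<and> Y \<noteq> {}} = 4"
    unfolding subsystems card_image [OF inj_one_mark_shift] .
  have "quasiminimal ?S X" unfolding quasiminimal_def proper_subsystems_X by simp
  moreover have "Pow {1, 2} = {{1, 2}, {2}, {1}, {} :: nat set}" by (auto simp: Pow_insert)
  then have "{Y. subsystem ?S X Y \<and> Y \<noteq> X \<and> Y \<noteq> {}} =
       {lang_inv ?S {replicate a 0 @ [s] @ replicate b 0 |a s b. s \<in> {1, 2}},
        lang_inv ?S {replicate a 0 @ [2] @ replicate b 0 |a b. True},
        lang_inv ?S {replicate a 0 @ [1] @ replicate b 0 |a b. True},
        lang_inv ?S {replicate a 0 |a. True}}"
    using lang_inv_one_mark [of "{1, 2}"] lang_inv_one_mark [of "{1}"] lang_inv_one_mark [of "{2}"]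
    unfolding subsystems lang_inv_zeros by simp
  ultimately show ?thesis
    using subshift_X recursive_X [OF P] countable_X weakly_transitive_X complete card4
    by (intro exI [of _ ?S] exI [of _ X]) simp
qed

end
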